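(* Let a space $X$ admit a separately continuous transitive action $\theta:G\times X\to X$ of an $\omega$-narrow semitopological group $G$ such that $\theta$ is extendable to a separately continuous $s$-action $\widetilde\theta:G\times Y\to Y$ of $G$ on some compactification $Y$ of $X$. Then $X$ is skeletally Dugundji provided it contains a dense Čech-complete $k$-separable subspace.
   Context: All spaces are Tychonoff (including the underlying spaces of groups). A semitopological group is a group $G$ with a topology making the multiplication $G\times G\to G$ separately continuous. It is $\omega$-narrow if for every neighborhood $U$ of the neutral element there is a countable set $A\subset G$ with $UA=AU=G$. Actions are left actions $\theta:G\times X\to X$, written $\theta(g,x)=gx$; an action is separately continuous if $\theta$ is separately continuous, and transitive if for every $x\in X$ the map $\theta^x:G\to X$, $\theta^x(g)=gx$, is surjective. A separately continuous action $\theta$ of $G$ on a space $Z$ generates a right action $\Theta:G\times C(Z)\to C(Z)$, $\Theta(g,f)(z)=f(gz)$, where $C(Z)$ is the set of continuous real-valued functions on $Z$; $C_p(Z)$ denotes $C(Z)$ with the topology of pointwise convergence. The action $\theta$ is an $s$-action if every orbit $\{\Theta(g,f):g\in G\}$, $f\in C(Z)$, is a separable subset of $C_p(Z)$. A space is $k$-separable if it contains a dense $\sigma$-compact subset. A continuous map $f:X\to Y$ is skeletal if $\operatorname{Int}\overline{f(U)}\neq\varnothing$ for every nonempty open $U\subset X$ (closure and interior in $Y$). A space $X$ is skeletally Dugundji if there is a well-ordered inverse system $S=\{X_\alpha,p^\beta_\alpha,\alpha<\beta<\tau\}$, $\tau$ a cardinal (indices are ordinals below $\tau$), with surjective skeletal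 bonding maps $p^\beta_\alpha:X_\beta\to X_\alpha$, such that: (i) $X_0$ is separable metrizable and every $p^{\alpha+1}_\alpha$ has a metrizable kernel, i.e. there is a separable metrizable space $M_\alpha$ such that $X_{\alpha+1}$ is embedded in $X_\alpha\times M_\alpha$ and $p^{\alpha+1}_\alpha$ is the restriction to $X_{\alpha+1}$ of the projection $X_\alpha\times M_\alpha\to X_\alpha$; (ii) for every (nonzero) limit ordinal $\gamma<\tau$, $X_\gamma$ is a (dense) subspace of $\varprojlim\{X_\alpha,p^\beta_\alpha,\alpha<\beta<\gamma\}$ (via the natural map induced by the $p^\gamma_\alpha$); (iii) $X$ is embedded in $\varprojlim S$ so that $p_\alpha(X)=X_\alpha$ for each $\alpha$, where $p_\alpha:\varprojlim S\to X_\alpha$ is the limit projection; (iv) for every bounded continuous real-valued function $f$ on $\varprojlim S$ there are $\alpha<\tau$ and a continuous function $g$ on $X_\alpha$ with $f=g\circ p_\alpha$. *)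

theory Defs
  imports "HOL-Algebra.Group_Action" "HOL-Analysis.Analysis"
begin

definition Tychonoff_space :: "'a topology \<Rightarrow> bool" where
  "Tychonoff_space X \<longleftrightarrow> completely_regular_space X \<and> Hausdorff_space X"

definition dense_subset :: "'a topology \<Rightarrow> 'a set \<Rightarrow> bool" where
  "dense_subset X D \<longleftrightarrow> D \<subseteq> topspace X \<and> X closure_of D = topspace X"

definition compactification :: "'a topology \<Rightarrow> 'b topology \<Rightarrow> ('a \<Rightarrow> 'b) \<Rightarrow> bool" where
  "compactification X K e \<longleftrightarrow>
     compact_space K \<and> Hausdorff_space K \<and> embedding_map X K e \<and>
     dense_subset K (e ` topspace X)"

text \<open>A space is Cech-complete if it is Tychonoff and a \<open>G\<^sub>\<delta>\<close> in one (equivalently, in each) of its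
  compactifications. Restricting to compactifications on the type \<open>('a \<Rightarrow> real) \<Rightarrow> real\<close> loses
  nothing: the Stone-Cech compactification is a closed subspace of the power of \<open>[0,1]\<close> indexed
  by the continuous functions from \<open>X\<close> to \<open>[0,1]\<close>.\<close>

definition Cech_complete_space :: "'a topology \<Rightarrow> bool" where
  "Cech_complete_space X \<longleftrightarrow>
     Tychonoff_space X \<and>
     (\<exists>(K :: (('a \<Rightarrow> real) \<Rightarrow> real) topology) e.
        compactification X K e \<and> gdelta_in K (e ` topspace X))"

definition k_separable_space :: "'a topology \<Rightarrow> bool" where
  "k_separable_space X \<longleftrightarrow>
     (\<exists>\<K>. countable \<K> \<and> (\<forall>K\<in>\<K>. compactin X K) \<and> dense_subset X (\<Union>\<K>))"

definition semitopological_group :: "('g, 'm) monoid_scheme \<Rightarrow> 'g topology \<Rightarrow> bool" where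
  "semitopological_group G T \<longleftrightarrow>
     group G \<and> topspace T = carrier G \<and> Tychonoff_space T \<and>
     (\<forall>a\<in>carrier G. continuous_map T T (\<lambda>x. a \<otimes>\<^bsub>G\<^esub> x) \<and>
                    continuous_map T T (\<lambda>x. x \<otimes>\<^bsub>G\<^esub> a))"

definition omega_narrow :: "('g, 'm) monoid_scheme \<Rightarrow> 'g topology \<Rightarrow> bool" where
  "omega_narrow G T \<longleftrightarrow>
     (\<forall>U. U \<subseteq> carrier G \<and> (\<exists>V. openin T V \<and> \<one>\<^bsub>G\<^esub> \<in> V \<and> V \<subseteq> U) \<longrightarrow>
        (\<exists>A. countable A \<and> A \<subseteq> carrier G \<and>
             U <#>\<^bsub>G\<^esub> A = carrier G \<and> A <#>\<^bsub>G\<^esub> U = carrier G))"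

definition separately_continuous_action ::
  "('g, 'm) monoid_scheme \<Rightarrow> 'g topology \<Rightarrow> 'x topology \<Rightarrow> ('g \<Rightarrow> 'x \<Rightarrow> 'x) \<Rightarrow> bool" where
  "separately_continuous_action G T X \<theta> \<longleftrightarrow>
     group_action G (topspace X) \<theta> \<and>
     (\<forall>g\<in>carrier G. continuous_map X X (\<theta> g)) \<and>
     (\<forall>x\<in>topspace X. continuous_map T X (\<lambda>g. \<theta> g x))"

text \<open>The points of \<open>C\<^sub>p(Z)\<close> are the extensional continuous functions: \<open>powertop_real\<close> makes
  everything outside \<open>topspace Z\<close> undefined, hence also the \<open>restrict\<close> in the orbits below.\<close>

definition Cp :: "'z topology \<Rightarrow> ('z \<Rightarrow> real) topology" where
  "Cp Z = subtopology (powertop_real (topspace Z)) {f. continuous_map Z euclideanreal f}"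

definition s_action ::
  "('g, 'm) monoid_scheme \<Rightarrow> 'g topology \<Rightarrow> 'z topology \<Rightarrow> ('g \<Rightarrow> 'z \<Rightarrow> 'z) \<Rightarrow> bool" where
  "s_action G T Z \<theta> \<longleftrightarrow>
     separately_continuous_action G T Z \<theta> \<and>
     (\<forall>f\<in>topspace (Cp Z).
        separable_space
          (subtopology (Cp Z) {restrict (\<lambda>z. f (\<theta> g z)) (topspace Z) | g. g \<in> carrier G}))"

definition skeletal_map :: "'a topology \<Rightarrow> 'b topology \<Rightarrow> ('a \<Rightarrow> 'b) \<Rightarrow> bool" where
  "skeletal_map X Y f \<longleftrightarrow>
     continuous_map X Y f \<and>
     (\<forall>U. openin X U \<and> U \<noteq> {} \<longrightarrow> Y interior_of (Y closure_of (f ` U)) \<noteq> {})"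

text \<open>Separable metrizable spaces embed in the countable power of the reals, so the kernel \<open>M\<close>
  may be taken on the type \<open>nat \<Rightarrow> real\<close>.\<close>

definition metrizable_kernel :: "'a topology \<Rightarrow> 'b topology \<Rightarrow> ('a \<Rightarrow> 'b) \<Rightarrow> bool" where
  "metrizable_kernel X Y q \<longleftrightarrow>
     (\<exists>(M :: (nat \<Rightarrow> real) topology) h.
        metrizable_space M \<and> separable_space M \<and>
        embedding_map X (prod_topology Y M) h \<and> (\<forall>x\<in>topspace X. fst (h x) = q x))"

text \<open>Systems are indexed by the field of a well-order \<open>r\<close>. The index \<open>\<beta>\<close> is \<open>\<alpha> + 1\<close>
  if \<open>\<alpha>\<close> is the largest index strictly below it. The bonding map
  \<open>p \<alpha> \<beta>\<close> goes from \<open>Z \<beta>\<close> to \<open>Z \<alpha>\<close>.\<close>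

definition succ_index :: "'i rel \<Rightarrow> 'i \<Rightarrow> 'i \<Rightarrow> bool" where
  "succ_index r \<alpha> \<beta> \<longleftrightarrow> \<alpha> \<in> underS r \<beta> \<and> (\<forall>\<gamma>\<in>underS r \<beta>. (\<gamma>, \<alpha>) \<in> r)"

definition limit_index :: "'i rel \<Rightarrow> 'i \<Rightarrow> bool" where
  "limit_index r \<gamma> \<longleftrightarrow> \<gamma> \<in> Field r \<and> underS r \<gamma> \<noteq> {} \<and> (\<nexists>\<alpha>. succ_index r \<alpha> \<gamma>)"

definition inverse_limit ::
  "'i rel \<Rightarrow> 'i set \<Rightarrow> ('i \<Rightarrow> 'a topology) \<Rightarrow> ('i \<Rightarrow> 'i \<Rightarrow> 'a \<Rightarrow> 'a) \<Rightarrow> ('i \<Rightarrow> 'a) topology" where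
  "inverse_limit r I Z p =
     subtopology (product_topology Z I)
       {x. \<forall>\<beta>\<in>I. \<forall>\<alpha>\<in>I. \<alpha> \<in> underS r \<beta> \<longrightarrow> p \<alpha> \<beta> (x \<beta>) = x \<alpha>}"

definition skeletal_inverse_system ::
  "'i rel \<Rightarrow> ('i \<Rightarrow> 'a topology) \<Rightarrow> ('i \<Rightarrow> 'i \<Rightarrow> 'a \<Rightarrow> 'a) \<Rightarrow> bool" where
  "skeletal_inverse_system r Z p \<longleftrightarrow>
     Well_order r \<and>
     (\<forall>\<alpha>\<in>Field r. Tychonoff_space (Z \<alpha>)) \<and>
     (\<forall>\<beta>\<in>Field r. \<forall>\<alpha>\<in>underS r \<beta>.
        skeletal_map (Z \<beta>) (Z \<alpha>) (p \<alpha> \<beta>) \<and> p \<alpha> \<beta> ` topspace (Z \<beta>) = topspace (Z \<alpha>)) \<and>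
     (\<forall>\<gamma>\<in>Field r. \<forall>\<beta>\<in>underS r \<gamma>. \<forall>\<alpha>\<in>underS r \<beta>. \<forall>z\<in>topspace (Z \<gamma>).
        p \<alpha> \<beta> (p \<beta> \<gamma> z) = p \<alpha> \<gamma> z)"

text \<open>The definition asks for a system of arbitrary spaces indexed by an arbitrary cardinal.
  It loses nothing to ask for spaces on the type \<open>'a\<close> of the points of \<open>X\<close> and for indices in
  \<open>'a set set\<close>. Each \<open>Z \<alpha>\<close> is the image of \<open>X\<close> under a limit projection. The topologies
  that the \<open>Z \<alpha>\<close> induce on \<open>X\<close> increase with \<open>\<alpha>\<close> and determine the \<open>Z \<alpha>\<close>, so at most
  \<open>|Pow (topspace X)|\<close> of them are distinct when \<open>X\<close> is infinite. Deleting repetitions and then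
  repeating \<open>X\<close> itself at the end yields a system indexed by the cardinal \<open>|UNIV :: 'a set set|\<close>.
  If \<open>X\<close> is finite, it is discrete and one index suffices.\<close>

definition skeletally_Dugundji :: "'a topology \<Rightarrow> bool" where
  "skeletally_Dugundji X \<longleftrightarrow>
     (\<exists>(r :: 'a set set rel) (Z :: 'a set set \<Rightarrow> 'a topology) p.
        Card_order r \<and> skeletal_inverse_system r Z p \<and>
        (\<forall>\<alpha>\<in>Field r. underS r \<alpha> = {} \<longrightarrow> metrizable_space (Z \<alpha>) \<and> separable_space (Z \<alpha>)) \<and>
        (\<forall>\<alpha> \<beta>. succ_index r \<alpha> \<beta> \<longrightarrow> metrizable_kernel (Z \<beta>) (Z \<alpha>) (p \<alpha> \<beta>)) \<and>
        (\<forall>\<gamma>. limit_index r \<gamma> \<longrightarrow>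
           (let L = inverse_limit r (underS r \<gamma>) Z p;
                h = (\<lambda>z. restrict (\<lambda>\<alpha>. p \<alpha> \<gamma> z) (underS r \<gamma>))
            in embedding_map (Z \<gamma>) L h \<and> dense_subset L (h ` topspace (Z \<gamma>)))) \<and>
        (\<exists>e. embedding_map X (inverse_limit r (Field r) Z p) e \<and>
             (\<forall>\<alpha>\<in>Field r. (\<lambda>x. e x \<alpha>) ` topspace X = topspace (Z \<alpha>))) \<and>
        (\<forall>f. continuous_map (inverse_limit r (Field r) Z p) euclideanreal f \<and>
             bounded (f ` topspace (inverse_limit r (Field r) Z p)) \<longrightarrow>
             (\<exists>\<alpha>\<in>Field r. \<exists>g. continuous_map (Z \<alpha>) euclideanreal g \<and>
                (\<forall>x\<in>topspace (inverse_limit r (Field r) Z p). f x = g (x \<alpha>)))))"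

end

theory Submission
  imports Defs
begin

text \<open>The space \<open>X\<close> is a dense orbit in the compactum \<open>Y\<close>. Every set \<open>S\<close> of continuous real functions on
\<open>Y\<close> induces a weak topology on \<open>Y\<close>, which is compact, and one on \<open>X\<close>, whose Kolmogorov quotient is a
Tychonoff image of \<open>X\<close>. The inverse system consists of these quotients for an increasing family of
sets \<open>S\<close>. Adding countably many functions gives a bonding map with a metrizable kernel, taking
unions of sets of functions gives dense subspaces of inverse limits, and countable sets give
separable metrizable quotients. The group makes the bonding maps skeletal.

Call \<open>S\<close> fibre invariant if \<open>G\<close> permutes the fibres of the map \<open>y \<mapsto> (s y)\<^sub>s\<close>. A continuous function
on \<open>Y\<close> that is constant on these fibres is continuous in the weak topology, because \<open>Y\<close> is compact
(\<open>continuous_map_weak_topology_of_fibres\<close>); so \<open>G\<close> acts on \<open>Y\<close> by homeomorphisms of the weak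
topology as soon as \<open>S\<close> is fibre invariant. Since the action is an s-action, each continuous
function lies in a countable fibre invariant set: a countable dense part of its orbit, together with
the function itself, has the same fibres as the whole orbit (\<open>s_action_fibre_invariant\<close>). Unions of
fibre invariant sets are fibre invariant, and thus there are enough of them to generate the topology
of \<open>X\<close>.

A dense \<open>G\<^sub>\<delta>\<close> of a nonempty compactum is not meager, but a \<open>G\<^sub>\<delta>\<close> set of \<open>Y\<close> need not be one in a
weak topology. Here k-separability helps. The Cech-complete subspace \<open>D\<close> is the intersection of open sets \<open>C\<^sub>n\<close> of \<open>Y\<close>
(\<open>gdelta_in_compactification\<close>) and contains countably many compact sets \<open>K\<^sub>m\<close> with dense union.
Once \<open>S\<close> contains Urysohn functions separating each \<open>K\<^sub>m\<close> from the complement of each \<open>C\<^sub>n\<close>,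
countably many dense open sets of the weak topology have their intersection inside \<open>D\<close>
(\<open>dense_gdelta_functions\<close>), and the Baire category theorem shows that \<open>X\<close> is not a countable union
of sets that are nowhere dense in the weak topology of \<open>Y\<close> (\<open>somewhere_dense_member\<close>).

Skeletality follows. Let \<open>U\<close> be a nonempty open subset of \<open>X\<close>. As \<open>G\<close> is \<open>\<omega>\<close>-narrow and transitive on
\<open>X\<close>, countably many translates of \<open>U\<close> cover \<open>X\<close> (\<open>countable_translates_cover\<close>). One translate is
therefore somewhere dense in the weak topology, and translating back, so is \<open>U\<close> itself.

The final clause of the definition, that bounded continuous functions on the limit factor through
some stage, is obtained by letting the system reach \<open>X\<close> before its end: the functions needed to
generate the topology are indexed by pairs of a point and an open set. If the type of points is
infinite, there are fewer such pairs than sets of sets of points; if it is finite, the functions are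
countably many and already define the first space. From that stage on the system is constantly \<open>X\<close>.
The construction of the system from the functions is \<open>skeletally_Dugundji_criterion\<close>.\<close>

section \<open>Weak topologies\<close>

definition weak_topology :: "'a set \<Rightarrow> ('a \<Rightarrow> real) set \<Rightarrow> 'a topology" where
  "weak_topology A S = pullback_topology A (\<lambda>x. restrict (\<lambda>s. s x) S) (powertop_real S)"

lemma continuous_map_evaluation:
  "continuous_map W (powertop_real S) (\<lambda>w. restrict (\<lambda>s. s (g w)) S) \<longleftrightarrow>
     (\<forall>s\<in>S. continuous_map W euclideanreal (\<lambda>w. s (g w)))"
  by (auto simp: continuous_map_componentwise)

lemma topspace_weak_topology [simp]: "topspace (weak_topology A S) = A"
  by (auto simp: weak_topology_def topspace_pullback_topology)

lemma continuous_map_into_weak_topology: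
  "continuous_map W (weak_topology A S) g \<longleftrightarrow>
     g \<in> topspace W \<rightarrow> A \<and> (\<forall>s\<in>S. continuous_map W euclideanreal (\<lambda>w. s (g w)))"
proof -
  let ?ev = "\<lambda>x. restrict (\<lambda>s. s x) S"
  have ev: "continuous_map W (powertop_real S) (?ev \<circ> g) \<longleftrightarrow>
      (\<forall>s\<in>S. continuous_map W euclideanreal (\<lambda>w. s (g w)))"
    by (simp add: comp_def continuous_map_evaluation)
  have "continuous_map W (powertop_real S) (?ev \<circ> g)"
    if "continuous_map W (weak_topology A S) g"
  proof (rule continuous_map_compose [OF that])
    show "continuous_map (weak_topology A S) (powertop_real S) ?ev"
      unfolding weak_topology_def
      using continuous_map_pullback [OF continuous_map_id, of A ?ev "powertop_real S"]
      by (simp add: comp_def)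
  qed
  moreover have "continuous_map W (weak_topology A S) g"
    if "g \<in> topspace W \<rightarrow> A" "continuous_map W (powertop_real S) (?ev \<circ> g)"
    unfolding weak_topology_def
    using that by (intro continuous_map_pullback') auto
  ultimately show ?thesis
    using ev by (metis continuous_map_funspace topspace_weak_topology)
qed

lemma continuous_map_weak_topology:
  assumes "s \<in> S"
  shows "continuous_map (weak_topology A S) euclideanreal s"
  using continuous_map_into_weak_topology [of "weak_topology A S" A S "\<lambda>x. x"] assms by auto

lemma openin_weak_topology_coarser:
  assumes "\<And>s. s \<in> S \<Longrightarrow> continuous_map X euclideanreal s"
    and "openin (weak_topology (topspace X) S) U"
  shows "openin X U"
proof -
  have "continuous_map X (weak_topology (topspace X) S) (\<lambda>x. x)"
    using assms by (auto simp: continuous_map_into_weak_topology)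
  from openin_continuous_map_preimage [OF this assms(2)]
  show ?thesis
    using openin_subset [OF assms(2)] by (simp add: Collect_conj_eq Int_absorb1)
qed

lemma weak_topology_saturated:
  assumes "openin (weak_topology A S) U" and "x \<in> U" and "y \<in> A" and "\<And>s. s \<in> S \<Longrightarrow> s x = s y"
  shows "y \<in> U"
proof -
  obtain V where V: "U = (\<lambda>x. restrict (\<lambda>s. s x) S) -` V \<inter> A"
    using assms(1) by (auto simp: weak_topology_def openin_pullback_topology)
  have "restrict (\<lambda>s. s x) S = restrict (\<lambda>s. s y) S"
    using assms(4) by auto
  then show ?thesis
    using assms(2,3) by (auto simp: V)
qed

lemma completely_regular_space_pullback:
  assumes "completely_regular_space Y" and "f \<in> A \<rightarrow> topspace Y"
  shows "completely_regular_space (pullback_topology A f Y)"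
  unfolding completely_regular_space_def
proof (intro allI impI)
  fix C x
  assume C: "closedin (pullback_topology A f Y) C \<and> x \<in> topspace (pullback_topology A f Y) - C"
  have A: "topspace (pullback_topology A f Y) = A"
    using assms(2) by (auto simp: topspace_pullback_topology)
  obtain V where V: "openin Y V" "A - C = f -` V \<inter> A"
    using C by (auto simp: closedin_def A openin_pullback_topology)
  have xV: "f x \<in> topspace Y - (topspace Y - V)"
    using C V assms(2) by (auto simp: A)
  obtain h where h: "continuous_map Y (top_of_set {0..1::real}) h" "h (f x) = 0"
      "h ` (topspace Y - V) \<subseteq> {1}"
    using assms(1) V xV unfolding completely_regular_space_def
    by (meson closedin_diff closedin_topspace)
  have "(h \<circ> f) ` C \<subseteq> {1}"
  proof clarsimp
    fix z assume z: "z \<in> C"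
    then have "z \<in> A"
      using C closedin_subset [of "pullback_topology A f Y" C] by (auto simp: A)
    then have "f z \<in> topspace Y - V"
      using z V(2) assms(2) by auto
    then show "h (f z) = 1"
      using h(3) by auto
  qed
  then show "\<exists>g. continuous_map (pullback_topology A f Y) (top_of_set {0..1::real}) g \<and>
      g x = 0 \<and> g ` C \<subseteq> {1}"
    using continuous_map_pullback [OF h(1), of A f] h(2) by (metis comp_apply)
qed

lemma completely_regular_space_weak_topology:
  "completely_regular_space (weak_topology A S)"
  unfolding weak_topology_def
  by (intro completely_regular_space_pullback)
     (auto simp: completely_regular_space_product_topology metrizable_imp_completely_regular_space
      metrizable_space_euclidean)

lemma compact_space_weak_topology:
  assumes "compact_space Y" and "\<And>s. s \<in> S \<Longrightarrow> continuous_map Y euclideanreal s"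
  shows "compact_space (weak_topology (topspace Y) S)"
proof -
  have "continuous_map Y (weak_topology (topspace Y) S) (\<lambda>x. x)"
    using assms by (auto simp: continuous_map_into_weak_topology)
  then show ?thesis
    using assms(1) image_compactin [of Y "topspace Y"] by (force simp: compact_space_def)
qed

text \<open>The weak topologies on \<open>X\<close> come from weak topologies on its compactification, where the group and
the Baire category theorem are available; this identity moves between the two.\<close>

lemma weak_topology_comp:
  assumes "e \<in> A \<rightarrow> B"
  shows "weak_topology A ((\<lambda>s. s \<circ> e) ` S) = pullback_topology A e (weak_topology B S)"
    (is "?W = ?P")
proof -
  have A: "topspace ?P = A"
    using assms by (auto simp: topspace_pullback_topology)
  have e: "continuous_map ?W (weak_topology B S) e"
    unfolding continuous_map_into_weak_topology
  proof (intro conjI ballI)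
    fix s assume "s \<in> S"
    then show "continuous_map ?W euclideanreal (\<lambda>w. s (e w))"
      using continuous_map_weak_topology [of "s \<circ> e" "(\<lambda>s. s \<circ> e) ` S" A] by (simp add: comp_def)
  qed (use assms in auto)
  then have 1: "continuous_map ?W ?P (\<lambda>x. x)"
    by (intro continuous_map_pullback') (auto simp: comp_def)
  have 2: "continuous_map ?P ?W (\<lambda>x. x)"
    unfolding continuous_map_into_weak_topology
  proof (intro conjI ballI)
    fix s assume "s \<in> (\<lambda>s. s \<circ> e) ` S"
    then show "continuous_map ?P euclideanreal (\<lambda>w. s w)"
    proof (rule imageE)
      fix s' assume "s = s' \<circ> e" "s' \<in> S"
      then show ?thesis
        using continuous_map_pullback [OF continuous_map_weak_topology [OF \<open>s' \<in> S\<close>]]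
        by (simp add: comp_def)
    qed
  qed (auto simp: A)
  have "openin ?W U \<longleftrightarrow> openin ?P U" for U
    using openin_continuous_map_preimage [OF 1, of U] openin_continuous_map_preimage [OF 2, of U]
      openin_subset[of ?W U] openin_subset[of ?P U]
    by (auto simp: A Collect_conj_eq Int_absorb1)
  then show ?thesis
    by (simp add: topology_eq)
qed

text \<open>By the fibre condition, the preimage of a closed set \<open>C\<close> under \<open>h\<close> is the full preimage of its own
image under the evaluation map. That image is compact, hence closed in the power of the line.\<close>

lemma continuous_map_weak_topology_of_fibres:
  assumes "compact_space Y" and "\<And>s. s \<in> S \<Longrightarrow> continuous_map Y euclideanreal s"
    and "continuous_map Y euclideanreal h"
    and fib: "\<And>x y. x \<in> topspace Y \<Longrightarrow> y \<in> topspace Y \<Longrightarrow> (\<And>s. s \<in> S \<Longrightarrow> s x = s y) \<Longrightarrow> h x = h y"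
  shows "continuous_map (weak_topology (topspace Y) S) euclideanreal h"
  unfolding continuous_map_closedin
proof (intro conjI allI impI)
  let ?ev = "\<lambda>x. restrict (\<lambda>s. s x) S"
  fix C :: "real set" assume "closedin euclideanreal C"
  then have "closedin Y {x \<in> topspace Y. h x \<in> C}" (is "closedin Y ?D")
    using assms(3) closedin_continuous_map_preimage by blast
  then have "compactin Y ?D"
    using assms(1) closedin_compact_space by blast
  moreover have "continuous_map Y (powertop_real S) ?ev"
    using assms(2) by (simp add: continuous_map_evaluation [of _ _ "\<lambda>x. x"])
  ultimately have "compactin (powertop_real S) (?ev ` ?D)"
    using image_compactin by blast
  then have cl: "closedin (powertop_real S) (?ev ` ?D)"
    by (intro compactin_imp_closedin) (auto simp: Hausdorff_space_product_topology)
  have "continuous_map (weak_topology (topspace Y) S) (powertop_real S) ?ev"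
    by (rule iffD2 [OF continuous_map_evaluation [of _ _ "\<lambda>x. x"]])
       (simp add: continuous_map_weak_topology)
  from closedin_continuous_map_preimage [OF this cl]
  have "closedin (weak_topology (topspace Y) S) {x \<in> topspace Y. ?ev x \<in> ?ev ` ?D}"
    by simp
  moreover have "{x \<in> topspace Y. ?ev x \<in> ?ev ` ?D} = ?D"
  proof -
    have "h x \<in> C" if "x \<in> topspace Y" "?ev x = ?ev y" "y \<in> ?D" for x y
      using fib [of x y] that by (metis (mono_tags, lifting) mem_Collect_eq restrict_apply')
    then show ?thesis by blast
  qed
  ultimately show "closedin (weak_topology (topspace Y) S)
      {x \<in> topspace (weak_topology (topspace Y) S). h x \<in> C}"
    by simp
qed auto

section \<open>Quotients onto weak topologies\<close>

text \<open>A point is represented by a chosen point with the same values of all functions in \<open>S\<close>. So the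
Kolmogorov quotient of a weak topology becomes a subspace of the original set. All quotients of
\<open>X\<close> then live on one type, and \<open>weak_rep A S\<close> serves as the bonding map from every finer
quotient.\<close>

definition weak_rep :: "'a set \<Rightarrow> ('a \<Rightarrow> real) set \<Rightarrow> 'a \<Rightarrow> 'a" where
  "weak_rep A S x = (SOME z. z \<in> A \<and> (\<forall>s\<in>S. s z = s x))"

definition weak_quotient :: "'a set \<Rightarrow> ('a \<Rightarrow> real) set \<Rightarrow> 'a topology" where
  "weak_quotient A S = subtopology (weak_topology A S) (weak_rep A S ` A)"

lemma weak_rep:
  assumes "x \<in> A"
  shows weak_rep_in: "weak_rep A S x \<in> A" and weak_rep_eq: "s \<in> S \<Longrightarrow> s (weak_rep A S x) = s x"
proof -
  have "\<exists>z. z \<in> A \<and> (\<forall>s\<in>S. s z = s x)"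
    using assms by blast
  from someI_ex [OF this] show "weak_rep A S x \<in> A" "s \<in> S \<Longrightarrow> s (weak_rep A S x) = s x"
    by (auto simp: weak_rep_def)
qed

lemma weak_rep_cong:
  assumes "\<And>s. s \<in> S \<Longrightarrow> s x = s y"
  shows "weak_rep A S x = weak_rep A S y"
proof -
  have "(\<forall>s\<in>S. s z = s x) \<longleftrightarrow> (\<forall>s\<in>S. s z = s y)" for z
    using assms by metis
  then show ?thesis
    by (simp add: weak_rep_def)
qed

lemma weak_rep_weak_rep:
  assumes "S \<subseteq> S'" and "x \<in> A"
  shows "weak_rep A S (weak_rep A S' x) = weak_rep A S x"
  using weak_rep_eq [OF assms(2), of _ S'] assms(1) by (intro weak_rep_cong) auto

lemma weak_rep_fixed:
  assumes "x \<in> weak_rep A S ` A"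
  shows "weak_rep A S x = x"
  using assms weak_rep_weak_rep [OF subset_refl] by (metis imageE)

lemma topspace_weak_quotient [simp]: "topspace (weak_quotient A S) = weak_rep A S ` A"
  using weak_rep_in by (fastforce simp: weak_quotient_def)

lemma weak_rep_image_subset: "weak_rep A S ` A \<subseteq> A"
  using weak_rep_in by fastforce

lemma weak_quotient_eqI:
  assumes "x \<in> weak_rep A S ` A" and "y \<in> weak_rep A S ` A" and "\<And>s. s \<in> S \<Longrightarrow> s x = s y"
  shows "x = y"
  using assms weak_rep_cong [of S x y A] weak_rep_fixed by metis

lemma continuous_map_into_weak_quotient:
  "continuous_map W (weak_quotient A S) g \<longleftrightarrow>
     g \<in> topspace W \<rightarrow> weak_rep A S ` A \<and> (\<forall>s\<in>S. continuous_map W euclideanreal (\<lambda>w. s (g w)))"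
  using weak_rep_image_subset[of A S]
  unfolding weak_quotient_def continuous_map_in_subtopology continuous_map_into_weak_topology Pi_iff
  by blast

lemma continuous_map_weak_quotient:
  "s \<in> S \<Longrightarrow> continuous_map (weak_quotient A S) euclideanreal s"
  unfolding weak_quotient_def
  by (intro continuous_map_from_subtopology continuous_map_weak_topology)

lemma continuous_map_weak_rep:
  assumes "\<And>s. s \<in> S \<Longrightarrow> continuous_map X euclideanreal s" and "topspace X \<subseteq> A"
  shows "continuous_map X (weak_quotient A S) (weak_rep A S)"
  unfolding continuous_map_into_weak_quotient
proof (intro conjI ballI)
  fix s assume "s \<in> S"
  then show "continuous_map X euclideanreal (\<lambda>w. s (weak_rep A S w))"
    using assms weak_rep_eq [OF _ \<open>s \<in> S\<close>]
    by (intro continuous_map_eq [OF assms(1) [OF \<open>s \<in> S\<close>]]) auto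
qed (use assms in auto)

lemma continuous_map_weak_rep_mono:
  assumes "S \<subseteq> S'"
  shows "continuous_map (weak_quotient A S') (weak_quotient A S) (weak_rep A S)"
  using assms continuous_map_weak_quotient weak_rep_image_subset[of A S']
  by (intro continuous_map_weak_rep) auto

lemma weak_rep_image_weak_quotient:
  assumes "S \<subseteq> S'"
  shows "weak_rep A S ` weak_rep A S' ` A = weak_rep A S ` A"
  using weak_rep_weak_rep [OF assms] by (simp add: image_image cong: image_cong)

text \<open>The common reason for all embeddings below: the quotient carries the weak topology of \<open>S\<close>, so it is
enough that every function in \<open>S\<close> can be recovered continuously from the image point. This also gives
injectivity, since the functions in \<open>S\<close> separate the representatives.\<close>

lemma embedding_map_weak_quotient:
  assumes f: "continuous_map (weak_quotient A S) Y f"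
    and fac: "\<And>s. s \<in> S \<Longrightarrow> \<exists>k. continuous_map Y euclideanreal k \<and>
                (\<forall>x\<in>weak_rep A S ` A. k (f x) = s x)"
  shows "embedding_map (weak_quotient A S) Y f"
proof -
  let ?Q = "weak_quotient A S"
  define g where "g = inv_into (topspace ?Q) f"
  have inj: "inj_on f (topspace ?Q)"
  proof (rule inj_onI)
    fix x y assume xy: "x \<in> topspace ?Q" "y \<in> topspace ?Q" "f x = f y"
    then have "s x = s y" if "s \<in> S" for s
      using fac [OF that] by (metis topspace_weak_quotient)
    then show "x = y"
      using xy weak_quotient_eqI by (metis topspace_weak_quotient)
  qed
  have "continuous_map (subtopology Y (f ` topspace ?Q)) ?Q g"
    unfolding continuous_map_into_weak_quotient
  proof (intro conjI ballI)
    show "g \<in> topspace (subtopology Y (f ` topspace ?Q)) \<rightarrow> weak_rep A S ` A"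
      using inj by (auto simp: g_def)
  next
    fix s assume "s \<in> S"
    then obtain k where k: "continuous_map Y euclideanreal k" "\<forall>x\<in>weak_rep A S ` A. k (f x) = s x"
      using fac by blast
    show "continuous_map (subtopology Y (f ` topspace ?Q)) euclideanreal (\<lambda>w. s (g w))"
    proof (rule continuous_map_eq [OF continuous_map_from_subtopology [OF k(1)]])
      fix w assume "w \<in> topspace (subtopology Y (f ` topspace ?Q))"
      then show "k w = s (g w)"
        using k(2) inj by (auto simp: g_def)
    qed
  qed
  then have "homeomorphic_maps ?Q (subtopology Y (f ` topspace ?Q)) f g"
    using f inj by (auto simp: homeomorphic_maps_def continuous_map_in_subtopology g_def)
  then show ?thesis
    unfolding embedding_map_def homeomorphic_map_maps by blast
qed

lemma Tychonoff_space_weak_quotient: "Tychonoff_space (weak_quotient A S)"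
  unfolding Tychonoff_space_def
proof
  show "completely_regular_space (weak_quotient A S)"
    unfolding weak_quotient_def
    by (intro completely_regular_space_subtopology completely_regular_space_weak_topology)
  have "continuous_map (weak_quotient A S) (powertop_real S) (\<lambda>x. restrict (\<lambda>s. s x) S)"
    by (rule iffD2 [OF continuous_map_evaluation [of _ _ "\<lambda>x. x"]])
       (simp add: continuous_map_weak_quotient)
  moreover have "inj_on (\<lambda>x. restrict (\<lambda>s. s x) S) (topspace (weak_quotient A S))"
  proof (rule inj_onI)
    fix x y assume xy: "x \<in> topspace (weak_quotient A S)" "y \<in> topspace (weak_quotient A S)"
      "restrict (\<lambda>s. s x) S = restrict (\<lambda>s. s y) S"
    have "s x = s y" if "s \<in> S" for s
      using fun_cong [OF xy(3), of s] that by simp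
    then show "x = y"
      using xy weak_quotient_eqI [of x A S y] by simp
  qed
  moreover have "Hausdorff_space (powertop_real S)"
    by (simp add: Hausdorff_space_product_topology)
  ultimately show "Hausdorff_space (weak_quotient A S)"
    by (metis Hausdorff_space_injective_preimage)
qed

text \<open>The zero function is inserted because \<open>from_nat_into\<close> is unspecified on the empty set.\<close>

lemma continuous_map_enumeration:
  assumes "\<And>s. s \<in> C \<Longrightarrow> continuous_map X euclideanreal s"
  shows "continuous_map X euclidean (\<lambda>x n. from_nat_into (insert (\<lambda>_. 0) C) n x :: real)"
proof -
  have "continuous_map X euclideanreal (from_nat_into (insert (\<lambda>_. 0) C) n)" for n
    using from_nat_into [of "insert (\<lambda>_. 0) C" n] assms by auto
  then have "continuous_map X (powertop_real UNIV)
      (\<lambda>x n. from_nat_into (insert (\<lambda>_. 0) C) n x)"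
    by (simp add: continuous_map_componentwise_UNIV)
  then show ?thesis
    by (simp add: euclidean_product_topology)
qed

lemma continuous_map_coordinate: "continuous_map euclidean euclideanreal (\<lambda>m :: nat \<Rightarrow> real. m n)"
  by (simp add: continuous_on_product_coordinates)

lemma second_countable_euclidean:
  "second_countable (euclidean :: 'a :: second_countable_topology topology)"
proof -
  obtain \<B> :: "'a set set" where \<B>: "countable \<B>" "topological_basis \<B>"
    using ex_countable_basis by blast
  have "\<exists>V\<in>\<B>. x \<in> V \<and> V \<subseteq> U" if "open U" "x \<in> U" for U x
    using topological_basisE [OF \<B>(2) that] by metis
  then show ?thesis
    unfolding second_countable_def
    using \<B> topological_basis_open by (intro exI [of _ \<B>]) auto
qed

lemma countable_weak_quotient:
  assumes "countable S"
  shows "metrizable_space (weak_quotient A S)" and "separable_space (weak_quotient A S)"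
proof -
  let ?f = "\<lambda>x n. from_nat_into (insert (\<lambda>_. 0) S) n x :: real"
  have "embedding_map (weak_quotient A S) euclidean ?f"
  proof (rule embedding_map_weak_quotient)
    show "continuous_map (weak_quotient A S) euclidean ?f"
      by (intro continuous_map_enumeration continuous_map_weak_quotient)
    fix s assume "s \<in> S"
    then obtain n where "from_nat_into (insert (\<lambda>_. 0) S) n = s"
      using assms from_nat_into_surj [of "insert (\<lambda>_. 0) S" s] by blast
    then show "\<exists>k. continuous_map euclidean euclideanreal k \<and> (\<forall>x\<in>weak_rep A S ` A. k (?f x) = s x)"
      using continuous_map_coordinate by blast
  qed
  then have h: "weak_quotient A S homeomorphic_space subtopology euclidean (?f ` topspace (weak_quotient A S))"
    using embedding_map_imp_homeomorphic_space by blast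
  show "metrizable_space (weak_quotient A S)"
    using homeomorphic_metrizable_space [OF h] metrizable_space_euclidean metrizable_space_subtopology
    by blast
  show "separable_space (weak_quotient A S)"
    using homeomorphic_space_second_countability [OF h] second_countable_subtopology
      second_countable_euclidean second_countable_imp_separable_space by blast
qed

text \<open>The kernel is the countable power of the line, in which the values of the new functions are the
second coordinate.\<close>

lemma metrizable_kernel_weak_quotient:
  assumes "countable C"
  shows "metrizable_kernel (weak_quotient A (S \<union> C)) (weak_quotient A S) (weak_rep A S)"
  unfolding metrizable_kernel_def
proof (intro exI conjI ballI)
  let ?M = "euclidean :: (nat \<Rightarrow> real) topology"
  let ?Q = "weak_quotient A (S \<union> C)" and ?P = "prod_topology (weak_quotient A S) ?M"
  let ?c = "\<lambda>n. from_nat_into (insert (\<lambda>_. 0) C) n"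
  let ?h = "\<lambda>x. (weak_rep A S x, \<lambda>n. ?c n x)"
  show "metrizable_space ?M"
    by (rule metrizable_space_euclidean)
  show "separable_space ?M"
    by (intro second_countable_imp_separable_space second_countable_euclidean)
  show "fst (?h x) = weak_rep A S x" for x
    by simp
  show "embedding_map ?Q ?P ?h"
  proof (rule embedding_map_weak_quotient)
    have "continuous_map ?Q (weak_quotient A S) (weak_rep A S)"
      by (intro continuous_map_weak_rep_mono) auto
    moreover have "continuous_map ?Q ?M (\<lambda>x n. ?c n x)"
      by (intro continuous_map_enumeration continuous_map_weak_quotient) auto
    ultimately show "continuous_map ?Q ?P ?h"
      by (simp add: continuous_map_paired)
    fix s assume "s \<in> S \<union> C"
    moreover have "\<exists>n. ?c n = s" if "s \<in> C"
      using assms that by (intro from_nat_into_surj) auto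
    ultimately consider "s \<in> S" | n where "?c n = s"
      by blast
    then show "\<exists>k. continuous_map ?P euclideanreal k \<and>
        (\<forall>x\<in>weak_rep A (S \<union> C) ` A. k (?h x) = s x)"
    proof cases
      case 1
      have "continuous_map ?P euclideanreal (s \<circ> fst)"
        by (intro continuous_map_compose [OF continuous_map_fst] continuous_map_weak_quotient 1)
      moreover have "\<forall>x\<in>weak_rep A (S \<union> C) ` A. (s \<circ> fst) (?h x) = s x"
        using weak_rep_eq [OF _ 1] weak_rep_image_subset[of A "S \<union> C"] by auto
      ultimately show ?thesis by blast
    next
      case 2
      have "continuous_map ?P euclideanreal ((\<lambda>m. m n) \<circ> snd)"
        by (intro continuous_map_compose [OF continuous_map_snd] continuous_map_coordinate)
      then show ?thesis
        using 2 by (intro exI [of _ "(\<lambda>m. m n) \<circ> snd"]) auto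
    qed
  qed
qed

text \<open>Skeletality of the map between quotients is a statement about the two weak topologies on the same
set: open sets of a weak topology are unions of fibres, so passing to representatives neither
creates nor destroys density.\<close>

lemma skeletal_map_weak_quotient:
  assumes "S \<subseteq> S'"
    and skel: "\<And>U. openin (weak_topology A S') U \<Longrightarrow> U \<noteq> {} \<Longrightarrow>
          weak_topology A S interior_of (weak_topology A S closure_of U) \<noteq> {}"
  shows "skeletal_map (weak_quotient A S') (weak_quotient A S) (weak_rep A S)"
  unfolding skeletal_map_def
proof (intro conjI allI impI)
  show "continuous_map (weak_quotient A S') (weak_quotient A S) (weak_rep A S)"
    by (rule continuous_map_weak_rep_mono [OF assms(1)])
  fix U assume U: "openin (weak_quotient A S') U \<and> U \<noteq> {}"
  then obtain W where W: "openin (weak_topology A S') W" "U = W \<inter> weak_rep A S' ` A"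
    by (auto simp: weak_quotient_def openin_subtopology)
  then have "W \<noteq> {}"
    using U by auto
  define V where "V = weak_topology A S interior_of (weak_topology A S closure_of W)"
  have V: "openin (weak_topology A S) V" "V \<subseteq> weak_topology A S closure_of W" "V \<noteq> {}"
    using skel [OF W(1) \<open>W \<noteq> {}\<close>] by (simp_all add: V_def interior_of_subset)
  have VA: "V \<subseteq> A"
    using openin_subset [OF V(1)] by simp
  have rep_W: "weak_rep A S' w \<in> U" if "w \<in> W" for w
  proof -
    have "w \<in> A"
      using openin_subset [OF W(1)] that by auto
    then show ?thesis
      using weak_topology_saturated [OF W(1) that weak_rep_in] weak_rep_eq W(2) by (metis IntI imageI)
  qed
  let ?V = "V \<inter> weak_rep A S ` A"
  have "?V \<subseteq> weak_quotient A S closure_of (weak_rep A S ` U)"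
  proof
    fix z assume z: "z \<in> ?V"
    show "z \<in> weak_quotient A S closure_of (weak_rep A S ` U)"
      unfolding in_closure_of
    proof (intro conjI allI impI)
      show "z \<in> topspace (weak_quotient A S)"
        using z by simp
      fix N assume "z \<in> N \<and> openin (weak_quotient A S) N"
      then obtain N' where N: "openin (weak_topology A S) N'" "N = N' \<inter> weak_rep A S ` A" "z \<in> N'"
        by (auto simp: weak_quotient_def openin_subtopology)
      then obtain w where w: "w \<in> W" "w \<in> N'"
        using z V(2) by (force simp: in_closure_of)
      have "w \<in> A"
        using openin_subset [OF N(1)] w by auto
      then have "weak_rep A S w \<in> N"
        using weak_topology_saturated [OF N(1) w(2) weak_rep_in] weak_rep_eq N(2)
        by (metis IntI imageI)
      moreover have "weak_rep A S w = weak_rep A S (weak_rep A S' w)"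
        using weak_rep_weak_rep [OF assms(1) \<open>w \<in> A\<close>] by simp
      ultimately show "\<exists>y. y \<in> weak_rep A S ` U \<and> y \<in> N"
        using rep_W [OF w(1)] by auto
    qed
  qed
  moreover have "openin (weak_quotient A S) ?V"
    using V(1) by (auto simp: weak_quotient_def openin_subtopology)
  ultimately have "?V \<subseteq> weak_quotient A S interior_of (weak_quotient A S closure_of (weak_rep A S ` U))"
    by (rule interior_of_maximal)
  moreover have "?V \<noteq> {}"
  proof -
    obtain v where "v \<in> V" using V(3) by blast
    then have "weak_rep A S v \<in> ?V"
      using weak_topology_saturated [OF V(1) _ weak_rep_in] weak_rep_eq VA by (metis IntI imageI subsetD)
    then show ?thesis by blast
  qed
  ultimately show "weak_quotient A S interior_of
      (weak_quotient A S closure_of (weak_rep A S ` U)) \<noteq> {}"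
    by blast
qed

section \<open>Inverse limits of weak quotients\<close>

text \<open>Each function in the union already lives on some stage \<open>\<alpha>\<close>, where it is a continuous function of the
\<open>\<alpha>\<close>-th coordinate of a thread.\<close>

lemma embedding_map_inverse_limit:
  assumes mono: "\<And>\<alpha> \<beta>. \<alpha> \<in> I \<Longrightarrow> \<beta> \<in> I \<Longrightarrow> \<alpha> \<in> underS r \<beta> \<Longrightarrow> S \<alpha> \<subseteq> S \<beta>"
  shows "embedding_map (weak_quotient A (\<Union>\<alpha>\<in>I. S \<alpha>))
     (inverse_limit r I (\<lambda>\<alpha>. weak_quotient A (S \<alpha>)) (\<lambda>\<alpha> \<beta>. weak_rep A (S \<alpha>)))
     (\<lambda>x. restrict (\<lambda>\<alpha>. weak_rep A (S \<alpha>) x) I)"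
    (is "embedding_map ?Q ?L ?h")
proof (rule embedding_map_weak_quotient)
  let ?P = "product_topology (\<lambda>\<alpha>. weak_quotient A (S \<alpha>)) I"
  have "continuous_map ?Q ?P ?h"
    unfolding continuous_map_componentwise
  proof (intro conjI ballI)
    fix \<alpha> assume "\<alpha> \<in> I"
    then have "continuous_map ?Q (weak_quotient A (S \<alpha>)) (weak_rep A (S \<alpha>))"
      by (intro continuous_map_weak_rep_mono) auto
    then show "continuous_map ?Q (weak_quotient A (S \<alpha>)) (\<lambda>x. ?h x \<alpha>)"
      using \<open>\<alpha> \<in> I\<close> by simp
  qed auto
  moreover have "weak_rep A (S \<alpha>) (?h x \<beta>) = ?h x \<alpha>"
    if "x \<in> topspace ?Q" "\<alpha> \<in> I" "\<beta> \<in> I" "\<alpha> \<in> underS r \<beta>" for x \<alpha> \<beta>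
    using that mono weak_rep_image_subset[of A] by (auto intro!: weak_rep_weak_rep weak_rep_in)
  ultimately show "continuous_map ?Q ?L ?h"
    unfolding inverse_limit_def continuous_map_in_subtopology by blast
next
  fix s assume "s \<in> (\<Union>\<alpha>\<in>I. S \<alpha>)"
  then obtain \<alpha> where \<alpha>: "\<alpha> \<in> I" "s \<in> S \<alpha>" by blast
  have "continuous_map ?L (weak_quotient A (S \<alpha>)) (\<lambda>u. u \<alpha>)"
    unfolding inverse_limit_def
    by (intro continuous_map_from_subtopology continuous_map_product_projection \<alpha>)
  from continuous_map_compose [OF this continuous_map_weak_quotient [OF \<alpha>(2)]]
  have "continuous_map ?L euclideanreal (\<lambda>u. s (u \<alpha>))"
    by (simp add: comp_def)
  moreover have "s (?h x \<alpha>) = s x" if "x \<in> topspace ?Q" for x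
    using weak_rep_eq [OF _ \<alpha>(2)] that \<alpha>(1) weak_rep_image_subset[of A "\<Union>\<alpha>\<in>I. S \<alpha>"] by auto
  ultimately show "\<exists>k. continuous_map ?L euclideanreal k \<and>
      (\<forall>x\<in>weak_rep A (\<Union>\<alpha>\<in>I. S \<alpha>) ` A. k (?h x) = s x)"
    by (intro exI [of _ "\<lambda>u. s (u \<alpha>)"]) auto
qed

lemma Well_order_finite_max:
  assumes "Well_order r" and "finite F" and "F \<noteq> {}" and "F \<subseteq> Field r"
  shows "\<exists>m\<in>F. \<forall>\<alpha>\<in>F. \<alpha> = m \<or> \<alpha> \<in> underS r m"
proof -
  have "\<exists>m\<in>F. \<forall>\<alpha>\<in>F. (\<alpha>, m) \<in> r"
    using assms(2,3,4)
  proof (induction rule: finite_ne_induct)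
    case (singleton x)
    then show ?case
      using assms(1) by (auto simp: order_on_defs refl_on_def)
  next
    case (insert x F)
    then obtain m where m: "m \<in> F" "\<forall>\<alpha>\<in>F. (\<alpha>, m) \<in> r" by auto
    have tot: "(x, m) \<in> r \<or> (m, x) \<in> r"
      using assms(1) insert.prems m(1) unfolding order_on_defs refl_on_def total_on_def
      by (metis insert_subset subsetD)
    show ?case
    proof (cases "(x, m) \<in> r")
      case False
      then have "(m, x) \<in> r" using tot by blast
      moreover have "(x, x) \<in> r"
        using assms(1) insert.prems by (auto simp: order_on_defs refl_on_def)
      moreover have "trans r"
        using assms(1) by (auto simp: order_on_defs)
      ultimately show ?thesis
        using m by (auto intro: transD)
    qed (use m in auto)
  qed
  then show ?thesis
    by (auto simp: underS_def)
qed

text \<open>A basic neighbourhood of a thread restricts finitely many coordinates, and the largest of these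
determines the others. A point of \<open>A\<close> representing that coordinate thus gives a thread in the
neighbourhood.\<close>

lemma dense_subset_inverse_limit:
  fixes r :: "'i rel" and S :: "'i \<Rightarrow> ('a \<Rightarrow> real) set" and A :: "'a set"
  assumes r: "Well_order r" and I: "I \<subseteq> Field r" "I \<noteq> {}"
    and T: "\<And>\<alpha>. \<alpha> \<in> I \<Longrightarrow> S \<alpha> \<subseteq> T"
  defines "L \<equiv> inverse_limit r I (\<lambda>\<alpha>. weak_quotient A (S \<alpha>)) (\<lambda>\<alpha> \<beta>. weak_rep A (S \<alpha>))"
  assumes sub: "(\<lambda>x. restrict (\<lambda>\<alpha>. weak_rep A (S \<alpha>) x) I) ` weak_rep A T ` A \<subseteq> topspace L"
  shows "dense_subset L ((\<lambda>x. restrict (\<lambda>\<alpha>. weak_rep A (S \<alpha>) x) I) ` weak_rep A T ` A)"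
    (is "dense_subset L (?h ` ?R)")
proof -
  let ?P = "product_topology (\<lambda>\<alpha>. weak_quotient A (S \<alpha>)) I"
  obtain K where K: "L = subtopology ?P K"
    by (auto simp: L_def inverse_limit_def)
  have "u \<in> L closure_of (?h ` ?R)" if u: "u \<in> topspace L" for u
    unfolding in_closure_of
  proof (intro conjI allI impI u)
    fix N assume "u \<in> N \<and> openin L N"
    then obtain N' where N': "openin ?P N'" "N = N' \<inter> K" "u \<in> N'"
      by (auto simp: K openin_subtopology)
    then obtain U where U: "finite {\<alpha> \<in> I. U \<alpha> \<noteq> topspace (weak_quotient A (S \<alpha>))}"
        "u \<in> Pi\<^sub>E I U" "Pi\<^sub>E I U \<subseteq> N'"
      unfolding openin_product_topology_alt by blast
    \<comment> \<open>The index \<open>i\<close> keeps the set of restricted coordinates nonempty, so that it has a maximum.\<close>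
    obtain i where i: "i \<in> I" using I by blast
    let ?F = "insert i {\<alpha> \<in> I. U \<alpha> \<noteq> topspace (weak_quotient A (S \<alpha>))}"
    have "finite ?F" "?F \<noteq> {}" "?F \<subseteq> Field r"
      using U(1) i I(1) by auto
    then obtain m where m: "m \<in> ?F" "\<forall>\<alpha>\<in>?F. \<alpha> = m \<or> \<alpha> \<in> underS r m"
      using Well_order_finite_max [OF r] by (metis (no_types, lifting))
    have mI: "m \<in> I" using m i by auto
    have um: "u m \<in> weak_rep A (S m) ` A"
      using u mI by (auto simp: L_def inverse_limit_def PiE_iff)
    then have umA: "u m \<in> A"
      using weak_rep_image_subset [of A "S m"] by blast
    let ?x = "weak_rep A T (u m)"
    have agree: "?h ?x \<alpha> = u \<alpha>" if "\<alpha> \<in> ?F" for \<alpha>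
    proof -
      have "\<alpha> \<in> I" using that i by auto
      have "?h ?x \<alpha> = weak_rep A (S \<alpha>) (u m)"
        using weak_rep_weak_rep [OF T umA] \<open>\<alpha> \<in> I\<close> by simp
      also have "\<dots> = u \<alpha>"
      proof (cases "\<alpha> = m")
        case True
        then show ?thesis using weak_rep_fixed [OF um] by simp
      next
        case False
        then have "\<alpha> \<in> underS r m" using bspec [OF m(2) that] by blast
        then show ?thesis
          using u mI \<open>\<alpha> \<in> I\<close> by (auto simp: L_def inverse_limit_def)
      qed
      finally show ?thesis .
    qed
    have "?h ?x \<alpha> \<in> U \<alpha>" if "\<alpha> \<in> I" for \<alpha>
    proof (cases "U \<alpha> = topspace (weak_quotient A (S \<alpha>))")
      case True
      then show ?thesis
        using that weak_rep_in [OF umA, of T] by auto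
    next
      case False
      then show ?thesis
        using agree [of \<alpha>] that U(2) by (auto simp: PiE_iff)
    qed
    then have "?h ?x \<in> Pi\<^sub>E I U"
      by (simp add: PiE_iff)
    then have "?h ?x \<in> N'"
      using U(3) by blast
    moreover have "?h ?x \<in> ?h ` ?R"
      using umA by blast
    moreover have "topspace L \<subseteq> K"
      by (simp add: K)
    ultimately show "\<exists>y. y \<in> ?h ` ?R \<and> y \<in> N"
      using N'(2) sub by blast
  qed
  then have "topspace L \<subseteq> L closure_of (?h ` ?R)"
    by (rule subsetI)
  then show ?thesis
    unfolding dense_subset_def using sub by (simp add: closure_of_subset_topspace subset_antisym)
qed

text \<open>If the functions separate points from closed sets, nothing is identified and no open set is lost.
This is the stage at which the inverse system reaches \<open>X\<close>.\<close>

lemma weak_quotient_eq_space: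
  assumes H: "Hausdorff_space X"
    and cont: "\<And>s. s \<in> S \<Longrightarrow> continuous_map X euclideanreal s"
    and gen: "\<And>U x. openin X U \<Longrightarrow> x \<in> U \<Longrightarrow>
        \<exists>s\<in>S. \<exists>V. open V \<and> s x \<in> V \<and> (\<forall>z\<in>topspace X. s z \<in> V \<longrightarrow> z \<in> U)"
  shows "\<And>x. x \<in> topspace X \<Longrightarrow> weak_rep (topspace X) S x = x"
    and "weak_quotient (topspace X) S = X"
proof -
  show rep: "weak_rep (topspace X) S x = x" if x: "x \<in> topspace X" for x
  proof (rule ccontr)
    let ?z = "weak_rep (topspace X) S x"
    assume "?z \<noteq> x"
    then obtain U where U: "openin X U" "x \<in> U" "?z \<notin> U"
      using H [unfolded Hausdorff_space_def, rule_format, of x ?z] x weak_rep_in [OF x]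
      by (auto simp: disjnt_iff)
    obtain s V where "s \<in> S" "s x \<in> V" "\<forall>z\<in>topspace X. s z \<in> V \<longrightarrow> z \<in> U"
      using gen [OF U(1,2)] by blast
    then show False
      using U(3) weak_rep_in [OF x] weak_rep_eq [OF x, of s S] by simp
  qed
  have "openin (weak_topology (topspace X) S) U" if "openin X U" for U
  proof (subst openin_subopen, intro ballI)
    fix x assume "x \<in> U"
    then obtain s V where sV: "s \<in> S" "open V" "s x \<in> V" "\<forall>z\<in>topspace X. s z \<in> V \<longrightarrow> z \<in> U"
      using gen [OF \<open>openin X U\<close> \<open>x \<in> U\<close>] by blast
    have "openin (weak_topology (topspace X) S) {z \<in> topspace X. s z \<in> V}"
      using openin_continuous_map_preimage [OF continuous_map_weak_topology [OF sV(1)], of V] sV(2)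
      by auto
    then show "\<exists>W. openin (weak_topology (topspace X) S) W \<and> x \<in> W \<and> W \<subseteq> U"
      using sV openin_subset [OF \<open>openin X U\<close>] \<open>x \<in> U\<close> by blast
  qed
  then have "weak_topology (topspace X) S = X"
    using openin_weak_topology_coarser [OF cont] by (auto simp: topology_eq)
  moreover have "weak_rep (topspace X) S ` topspace X = topspace X"
    using rep by auto
  ultimately show "weak_quotient (topspace X) S = X"
    by (simp add: weak_quotient_def)
qed

section \<open>A criterion for skeletally Dugundji spaces\<close>

text \<open>The pairs in the domain of \<open>\<psi>\<close> index neighbourhoods of points. If \<open>'a\<close> is infinite, there are at most
as many of them as subsets of \<open>'a\<close>, hence strictly fewer than sets of subsets, and they can be
enumerated by a proper initial segment of the cardinal of the type \<open>'a set set\<close>. If \<open>'a\<close> is finite,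
a proper initial segment may be too short, but the whole range of \<open>\<psi>\<close> is countable and goes
into \<open>A0\<close>.\<close>

lemma enumeration_along_initial_segment:
  includes cardinal_syntax
  fixes \<psi> :: "'a \<times> 'a set \<Rightarrow> 'c"
  obtains A0 and \<Phi> :: "'a set set \<Rightarrow> 'c" and a :: "'a set set"
  where "countable A0" and "A0 \<subseteq> range \<psi>" and "range \<Phi> \<subseteq> range \<psi>"
    and "range \<psi> \<subseteq> A0 \<union> \<Phi> ` underS |UNIV :: 'a set set set| a"
proof (cases "finite (UNIV :: 'a set)")
  case True
  then have "finite (UNIV :: ('a \<times> 'a set) set)"
    by (simp add: finite_Prod_UNIV Finite_Set.finite_set)
  then have "countable (range \<psi>)"
    by (simp add: countable_finite)
  then show ?thesis
    using that [of "range \<psi>" "\<lambda>_. \<psi> undefined"] by auto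
next
  case False
  let ?r = "|UNIV :: 'a set set set|"
  have inf: "infinite (UNIV :: 'a set set)"
    using False by (simp add: Finite_Set.finite_set)
  have "|UNIV :: ('a \<times> 'a set) set| \<le>o |(UNIV :: 'a set set) \<times> (UNIV :: 'a set set)|"
    by (rule card_of_ordLeqI [of "\<lambda>(x, U). ({x}, U)"]) (auto simp: inj_on_def)
  also have "|(UNIV :: 'a set set) \<times> (UNIV :: 'a set set)| =o |UNIV :: 'a set set|"
    by (rule card_of_Times_same_infinite [OF inf])
  also have "|UNIV :: 'a set set| <o ?r"
    using card_of_Pow [of "UNIV :: 'a set set"] by simp
  finally have "|UNIV :: ('a \<times> 'a set) set| <o ?r" .
  then obtain a where "a \<in> Field ?r" "|UNIV :: ('a \<times> 'a set) set| =o Restr ?r (underS ?r a)"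
    by (auto simp: ordLess_iff_ordIso_Restr [OF card_of_Well_order card_of_Well_order])
  then obtain f where f: "BNF_Wellorder_Embedding.iso |UNIV :: ('a \<times> 'a set) set| (Restr ?r (underS ?r a)) f"
    unfolding ordIso_def by blast
  have "Field (Restr ?r (underS ?r a)) \<subseteq> underS ?r a"
    by (auto simp: Field_def)
  then have bij: "inj f" "range f \<subseteq> underS ?r a"
    using f by (auto simp: BNF_Wellorder_Embedding.iso_def Field_card_of bij_betw_def)
  have "range \<psi> \<subseteq> (\<psi> \<circ> inv_into UNIV f) ` underS ?r a"
  proof
    fix y assume "y \<in> range \<psi>"
    then obtain u where "y = \<psi> u" by blast
    then have "y = (\<psi> \<circ> inv_into UNIV f) (f u)" "f u \<in> underS ?r a"
      using bij by auto
    then show "y \<in> (\<psi> \<circ> inv_into UNIV f) ` underS ?r a" by blast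
  qed
  then show ?thesis
    using that [of "{}" "\<psi> \<circ> inv_into UNIV f" a] by auto
qed

text \<open>The functions of \<open>S0\<close> and those of a countable part of \<open>\<S>\<close> define the first space. Each index
contributes one further countable set to all later spaces. Skeletality is asked for all subfamilies
of \<open>\<S>\<close> that contain \<open>S0\<close> because every stage is given by such a subfamily.\<close>

lemma skeletally_Dugundji_criterion:
  fixes X :: "'a topology" and \<S> :: "('a \<Rightarrow> real) set set"
  assumes H: "Hausdorff_space X"
    and count: "\<And>S. S \<in> \<S> \<Longrightarrow> countable S"
    and cont: "\<And>S s. S \<in> \<S> \<Longrightarrow> s \<in> S \<Longrightarrow> continuous_map X euclideanreal s"
    and S0: "S0 \<in> \<S>"
    and gen: "\<And>U x. openin X U \<Longrightarrow> x \<in> U \<Longrightarrow>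
        \<exists>S\<in>\<S>. \<exists>s\<in>S. \<exists>V. open V \<and> s x \<in> V \<and> (\<forall>z\<in>topspace X. s z \<in> V \<longrightarrow> z \<in> U)"
    and skel: "\<And>\<A> U. \<A> \<subseteq> \<S> \<Longrightarrow> S0 \<in> \<A> \<Longrightarrow> openin X U \<Longrightarrow> U \<noteq> {} \<Longrightarrow>
        weak_topology (topspace X) (\<Union>\<A>) interior_of
          (weak_topology (topspace X) (\<Union>\<A>) closure_of U) \<noteq> {}"
  shows "skeletally_Dugundji X"
proof -
  let ?A = "topspace X"
  define r where "r = card_of (UNIV :: 'a set set set)"
  have r: "Card_order r" "Well_order r" "Field r = UNIV"
    unfolding r_def by (rule card_of_Card_order, rule card_of_Well_order, rule Field_card_of)
  have ord: "trans r" "antisym r" "total r" "refl r"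
    using r(2,3) by (auto simp: order_on_defs)
  have underS_mono: "underS r \<alpha> \<subseteq> underS r \<beta>" if "\<alpha> \<in> underS r \<beta>" for \<alpha> \<beta>
    using that ord(1,2) by (intro underS_incr) (auto simp: underS_def)
  have compare: "\<alpha> = \<beta> \<or> \<alpha> \<in> underS r \<beta> \<or> \<beta> \<in> underS r \<alpha>" for \<alpha> \<beta>
    using ord(3) by (auto simp: total_on_def underS_def)

  have "\<exists>S. S \<in> \<S> \<and> (openin X U \<and> x \<in> U \<longrightarrow>
      (\<exists>s\<in>S. \<exists>V. open V \<and> s x \<in> V \<and> (\<forall>z\<in>?A. s z \<in> V \<longrightarrow> z \<in> U)))" for x U
    using gen [of U x] S0 by blast
  then have "\<exists>\<psi>. \<forall>u. \<psi> u \<in> \<S> \<and> (openin X (snd u) \<and> fst u \<in> snd u \<longrightarrow>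
      (\<exists>s\<in>\<psi> u. \<exists>V. open V \<and> s (fst u) \<in> V \<and> (\<forall>z\<in>?A. s z \<in> V \<longrightarrow> z \<in> snd u)))"
    by (intro choice) auto
  then obtain \<psi> where \<psi>_in: "\<And>u. \<psi> u \<in> \<S>" and \<psi>: "\<And>U x. openin X U \<Longrightarrow> x \<in> U \<Longrightarrow>
      \<exists>s\<in>\<psi> (x, U). \<exists>V. open V \<and> s x \<in> V \<and> (\<forall>z\<in>?A. s z \<in> V \<longrightarrow> z \<in> U)"
    by (metis fst_conv snd_conv)
  obtain A0 and \<Phi> :: "'a set set \<Rightarrow> ('a \<Rightarrow> real) set" and a
    where A0: "countable A0" "A0 \<subseteq> range \<psi>" and \<Phi>: "range \<Phi> \<subseteq> range \<psi>"
      and all: "range \<psi> \<subseteq> A0 \<union> \<Phi> ` underS r a"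
    using enumeration_along_initial_segment [of \<psi>] unfolding r_def by metis

  have \<Phi>_in: "\<Phi> i \<in> \<S>" for i
    using subsetD [OF \<Phi> rangeI, of i] \<psi>_in by auto

  define \<F> where "\<F> \<alpha> = insert S0 A0 \<union> \<Phi> ` underS r \<alpha>" for \<alpha>
  define S where "S \<alpha> = \<Union>(\<F> \<alpha>)" for \<alpha>
  define Z where "Z \<alpha> = weak_quotient ?A (S \<alpha>)" for \<alpha>
  define p where "p \<alpha> (\<beta> :: 'a set set) = weak_rep ?A (S \<alpha>)" for \<alpha> \<beta>
  have \<F>: "\<F> \<alpha> \<subseteq> \<S>" for \<alpha>
  proof -
    have "A0 \<subseteq> \<S>"
      using A0(2) \<psi>_in by auto
    then show ?thesis
      using \<Phi>_in S0 by (auto simp: \<F>_def)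
  qed
  have S_cont: "continuous_map X euclideanreal s" if s: "s \<in> S \<alpha>" for s \<alpha>
  proof -
    obtain T where T: "T \<in> \<F> \<alpha>" "s \<in> T"
      using s unfolding S_def by blast
    show ?thesis
      by (rule cont [OF subsetD [OF \<F> T(1)] T(2)])
  qed
  have S_mono: "S \<alpha> \<subseteq> S \<beta>" if "\<alpha> \<in> underS r \<beta>" for \<alpha> \<beta>
    using underS_mono [OF that] unfolding S_def \<F>_def by blast
  have S_skel: "weak_topology ?A (S \<alpha>) interior_of (weak_topology ?A (S \<alpha>) closure_of U) \<noteq> {}"
    if "openin (weak_topology ?A (S \<beta>)) U" "U \<noteq> {}" for \<alpha> \<beta> U
  proof -
    have "openin X U"
      by (rule openin_weak_topology_coarser [OF S_cont that(1)])
    then show ?thesis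
      using skel [of "\<F> \<alpha>" U] \<F> [of \<alpha>] that(2) by (simp add: S_def \<F>_def)
  qed

  have gen_a: "\<exists>s\<in>T. \<exists>V. open V \<and> s x \<in> V \<and> (\<forall>z\<in>?A. s z \<in> V \<longrightarrow> z \<in> U)"
    if "S a \<subseteq> T" "openin X U" "x \<in> U" for T U x
  proof -
    have "\<psi> (x, U) \<in> \<F> a"
      using subsetD [OF all rangeI, of "(x, U)"] by (simp add: \<F>_def disj_ac)
    then have "\<psi> (x, U) \<subseteq> S a"
      unfolding S_def by (rule Union_upper)
    then show ?thesis
      using \<psi> [OF that(2,3)] that(1) by blast
  qed
  \<comment> \<open>The stage \<open>a\<close> has all functions chosen by \<open>\<psi>\<close>, so from there on the system is constantly \<open>X\<close>.\<close>
  have late: "weak_rep ?A (S \<beta>) x = x" if "S a \<subseteq> S \<beta>" "x \<in> ?A" for \<beta> x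
    by (rule weak_quotient_eq_space(1) [OF H S_cont gen_a [OF that(1)] that(2)])
  have Z_a: "Z a = X"
    unfolding Z_def by (rule weak_quotient_eq_space(2) [OF H S_cont gen_a [OF subset_refl]])

  have sys: "skeletal_inverse_system r Z p"
    unfolding skeletal_inverse_system_def
  proof (intro conjI ballI r)
    show "Tychonoff_space (Z \<alpha>)" for \<alpha>
      by (simp add: Z_def Tychonoff_space_weak_quotient)
  next
    fix \<beta> \<alpha> assume "\<alpha> \<in> underS r \<beta>"
    then have mono: "S \<alpha> \<subseteq> S \<beta>" by (rule S_mono)
    show "skeletal_map (Z \<beta>) (Z \<alpha>) (p \<alpha> \<beta>)"
      unfolding Z_def p_def by (rule skeletal_map_weak_quotient [OF mono S_skel])
    show "p \<alpha> \<beta> ` topspace (Z \<beta>) = topspace (Z \<alpha>)"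
      by (simp add: Z_def p_def weak_rep_image_weak_quotient [OF mono])
  next
    fix \<gamma> \<beta> \<alpha> z assume "\<beta> \<in> underS r \<gamma>" "\<alpha> \<in> underS r \<beta>" "z \<in> topspace (Z \<gamma>)"
    then show "p \<alpha> \<beta> (p \<beta> \<gamma> z) = p \<alpha> \<gamma> z"
      using weak_rep_weak_rep [OF S_mono, of \<alpha> \<beta> z ?A] weak_rep_image_subset [of ?A "S \<gamma>"]
      by (auto simp: Z_def p_def)
  qed

  have base: "metrizable_space (Z \<alpha>) \<and> separable_space (Z \<alpha>)" if "underS r \<alpha> = {}" for \<alpha>
  proof -
    have "countable (S \<alpha>)"
      unfolding S_def
    proof (rule countable_UN [of _ "\<lambda>T. T", simplified])
      show "countable (\<F> \<alpha>)"
        using A0(1) that by (simp add: \<F>_def)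
      show "countable T" if "T \<in> \<F> \<alpha>" for T
        using count subsetD [OF \<F> that] by blast
    qed
    then show ?thesis
      by (simp add: Z_def countable_weak_quotient)
  qed

  have kernel: "metrizable_kernel (Z \<beta>) (Z \<alpha>) (p \<alpha> \<beta>)" if succ: "succ_index r \<alpha> \<beta>" for \<alpha> \<beta>
  proof -
    have "underS r \<beta> = insert \<alpha> (underS r \<alpha>)"
      using succ underS_mono [of \<alpha> \<beta>] by (auto simp: succ_index_def underS_def)
    then have "S \<beta> = S \<alpha> \<union> \<Phi> \<alpha>"
      by (auto simp: S_def \<F>_def)
    moreover have "countable (\<Phi> \<alpha>)"
      by (rule count [OF \<Phi>_in])
    ultimately show ?thesis
      by (simp add: Z_def p_def metrizable_kernel_weak_quotient)
  qed

  have embed: "embedding_map (weak_quotient ?A (\<Union>\<alpha>\<in>I. S \<alpha>)) (inverse_limit r I Z p)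
      (\<lambda>x. restrict (\<lambda>\<alpha>. weak_rep ?A (S \<alpha>) x) I)" for I
    unfolding Z_def p_def by (rule embedding_map_inverse_limit) (rule S_mono)

  have limit: "embedding_map (Z \<gamma>) (inverse_limit r (underS r \<gamma>) Z p)
        (\<lambda>z. restrict (\<lambda>\<alpha>. p \<alpha> \<gamma> z) (underS r \<gamma>)) \<and>
      dense_subset (inverse_limit r (underS r \<gamma>) Z p)
        ((\<lambda>z. restrict (\<lambda>\<alpha>. p \<alpha> \<gamma> z) (underS r \<gamma>)) ` topspace (Z \<gamma>))"
    if lim: "limit_index r \<gamma>" for \<gamma>
  proof -
    let ?I = "underS r \<gamma>"
    have ne: "?I \<noteq> {}"
      using lim by (simp add: limit_index_def)
    have above: "\<exists>\<delta>\<in>?I. i \<in> underS r \<delta>" if i: "i \<in> ?I" for i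
    proof -
      have "\<not> succ_index r i \<gamma>"
        using lim by (simp add: limit_index_def)
      then obtain \<delta> where "\<delta> \<in> ?I" "(\<delta>, i) \<notin> r"
        using i by (auto simp: succ_index_def)
      then show ?thesis
        using compare [of i \<delta>] ord(4) by (auto simp: underS_def refl_on_def)
    qed
    have "S \<gamma> = (\<Union>\<alpha>\<in>?I. S \<alpha>)"
    proof
      show "(\<Union>\<alpha>\<in>?I. S \<alpha>) \<subseteq> S \<gamma>"
        using S_mono by blast
      show "S \<gamma> \<subseteq> (\<Union>\<alpha>\<in>?I. S \<alpha>)"
      proof
        fix s assume "s \<in> S \<gamma>"
        then obtain T where T: "T \<in> \<F> \<gamma>" "s \<in> T"
          unfolding S_def by blast
        have "\<exists>\<alpha>\<in>?I. T \<in> \<F> \<alpha>"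
        proof (cases "T \<in> insert S0 A0")
          case True
          then show ?thesis using ne by (auto simp: \<F>_def)
        next
          case False
          then obtain i where "i \<in> ?I" "T = \<Phi> i"
            using T(1) by (auto simp: \<F>_def)
          then show ?thesis using above [of i] by (auto simp: \<F>_def)
        qed
        then show "s \<in> (\<Union>\<alpha>\<in>?I. S \<alpha>)"
          using T(2) unfolding S_def by blast
      qed
    qed
    then have emb: "embedding_map (Z \<gamma>) (inverse_limit r ?I Z p)
        (\<lambda>z. restrict (\<lambda>\<alpha>. p \<alpha> \<gamma> z) ?I)"
      using embed [of ?I] by (simp add: Z_def p_def)
    then have "(\<lambda>z. restrict (\<lambda>\<alpha>. p \<alpha> \<gamma> z) ?I) ` topspace (Z \<gamma>) \<subseteq> topspace (inverse_limit r ?I Z p)"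
      by (auto simp: embedding_map_def homeomorphic_eq_everything_map)
    then have "dense_subset (inverse_limit r ?I Z p)
        ((\<lambda>z. restrict (\<lambda>\<alpha>. p \<alpha> \<gamma> z) ?I) ` topspace (Z \<gamma>))"
      using dense_subset_inverse_limit [OF r(2) _ ne, where S = S and T = "S \<gamma>" and A = ?A]
        S_mono r(3) by (simp add: Z_def [abs_def] p_def [abs_def])
    with emb show ?thesis by blast
  qed

  let ?L = "inverse_limit r (Field r) Z p"
  define e where "e = (\<lambda>x. restrict (\<lambda>\<alpha>. weak_rep ?A (S \<alpha>) x) (Field r))"
  have emb: "embedding_map X ?L e"
  proof -
    have "weak_quotient ?A (\<Union>\<alpha>\<in>Field r. S \<alpha>) = X"
    proof (rule weak_quotient_eq_space(2) [OF H _ gen_a])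
      show "continuous_map X euclideanreal s" if "s \<in> (\<Union>\<alpha>\<in>Field r. S \<alpha>)" for s
        using that S_cont by blast
      show "S a \<subseteq> (\<Union>\<alpha>\<in>Field r. S \<alpha>)"
        using r(3) by blast
    qed
    then show ?thesis
      using embed [of "Field r"] by (simp add: e_def)
  qed
  have onto: "\<forall>\<alpha>\<in>Field r. (\<lambda>x. e x \<alpha>) ` topspace X = topspace (Z \<alpha>)"
    by (simp add: e_def Z_def)
  \<comment> \<open>A thread is determined by its coordinate at \<open>a\<close>, so the limit is \<open>X\<close> and \<open>e\<close> inverts the projection.\<close>
  have factor: "\<exists>\<alpha>\<in>Field r. \<exists>g. continuous_map (Z \<alpha>) euclideanreal g \<and>
      (\<forall>u\<in>topspace ?L. f u = g (u \<alpha>))"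
    if "continuous_map ?L euclideanreal f" for f
  proof (intro bexI exI conjI ballI)
    show "a \<in> Field r" by (simp add: r(3))
    have "continuous_map X ?L e"
      using emb by (auto simp: embedding_map_def homeomorphic_eq_everything_map
          continuous_map_in_subtopology)
    then show "continuous_map (Z a) euclideanreal (f \<circ> e)"
      unfolding Z_a using that by (rule continuous_map_compose)
    fix u assume u: "u \<in> topspace ?L"
    have ua: "u \<alpha> \<in> weak_rep ?A (S \<alpha>) ` ?A" for \<alpha>
      using u by (auto simp: inverse_limit_def r(3) Z_def)
    have uA: "u \<alpha> \<in> ?A" for \<alpha>
      using ua [of \<alpha>] weak_rep_image_subset [of ?A "S \<alpha>"] by blast
    have thread: "weak_rep ?A (S \<alpha>) (u \<beta>) = u \<alpha>" if "\<alpha> \<in> underS r \<beta>" for \<alpha> \<beta>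
      using u that by (auto simp: inverse_limit_def r(3) p_def)
    have "e (u a) \<alpha> = u \<alpha>" for \<alpha>
    proof -
      consider "\<alpha> = a" | "\<alpha> \<in> underS r a" | "a \<in> underS r \<alpha>"
        using compare by blast
      then have "weak_rep ?A (S \<alpha>) (u a) = u \<alpha>"
      proof cases
        case 1
        then show ?thesis using weak_rep_fixed [OF ua] by simp
      next
        case 2
        then show ?thesis by (rule thread)
      next
        case 3
        have "u a = u \<alpha>"
          using thread [OF 3] late [OF subset_refl uA, of \<alpha>] by simp
        then show ?thesis
          using late [OF S_mono [OF 3] uA] by simp
      qed
      then show ?thesis by (simp add: e_def r(3))
    qed
    then have "e (u a) = u" by blast
    then show "f u = (f \<circ> e) (u a)" by simp
  qed
  show ?thesis
    unfolding skeletally_Dugundji_def Let_def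
    using r(1) sys base kernel limit emb onto factor
    by (intro exI [of _ r] exI [of _ Z] exI [of _ p] conjI allI impI ballI exI [of _ e]) auto
qed

section \<open>Dense subsets, compactifications and Baire category\<close>

lemma dense_subset_trans:
  assumes "dense_subset X D" and "dense_subset (subtopology X D) E"
  shows "dense_subset X E"
proof -
  have E: "E \<subseteq> D" "D \<subseteq> topspace X"
    using assms by (auto simp: dense_subset_def)
  have "D \<subseteq> X closure_of E"
    using assms(2) E by (auto simp: dense_subset_def closure_of_subtopology Int_absorb1 Int_absorb2)
  then have "X closure_of D \<subseteq> X closure_of E"
    by (simp add: closure_of_minimal)
  then show ?thesis
    using assms(1) E closure_of_subset_topspace [of X E] by (auto simp: dense_subset_def)
qed

lemma dense_subset_image:
  assumes "continuous_map X Y e" and "dense_subset Y (e ` topspace X)" and "dense_subset X D"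
  shows "dense_subset Y (e ` D)"
proof -
  have "e ` topspace X \<subseteq> Y closure_of (e ` D)"
    using continuous_map_image_closure_subset [OF assms(1), of D] assms(3)
    by (simp add: dense_subset_def)
  then have "Y closure_of (e ` topspace X) \<subseteq> Y closure_of (e ` D)"
    by (simp add: closure_of_minimal)
  moreover have "e ` D \<subseteq> topspace Y"
    using assms(2,3) by (auto simp: dense_subset_def)
  ultimately show ?thesis
    using assms(2) closure_of_subset_topspace [of Y "e ` D"] by (auto simp: dense_subset_def)
qed

text \<open>A continuous map into a Hausdorff space has a closed graph in the product with its own domain. The
closure of the graph inside the larger product \<open>K \<times> Y\<close> therefore gains points only over the
remainder of \<open>K\<close>.\<close>

lemma graph_closure_over_image:
  assumes i: "embedding_map D K i" and f: "continuous_map D Y f" and Y: "Hausdorff_space Y"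
    and p: "(i d, y) \<in> prod_topology K Y closure_of ((\<lambda>x. (i x, f x)) ` topspace D)"
    and d: "d \<in> topspace D"
  shows "y = f d"
proof (rule ccontr)
  assume "y \<noteq> f d"
  have "y \<in> topspace Y"
    using p closure_of_subset_topspace by fastforce
  moreover have "f d \<in> topspace Y"
    using f d by (auto simp: continuous_map_def)
  ultimately obtain U V where UV: "openin Y U" "openin Y V" "y \<in> U" "f d \<in> V" "disjnt U V"
    using Y [unfolded Hausdorff_space_def, rule_format, of y "f d"] \<open>y \<noteq> f d\<close> by blast
  have "openin D {x \<in> topspace D. f x \<in> V}"
    using f UV(2) by (rule openin_continuous_map_preimage)
  then have "openin (subtopology K (i ` topspace D)) (i ` {x \<in> topspace D. f x \<in> V})"
    using homeomorphic_map_openness [OF i [unfolded embedding_map_def],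
        of "{x \<in> topspace D. f x \<in> V}"] by auto
  then obtain W where W: "openin K W" "i ` {x \<in> topspace D. f x \<in> V} = W \<inter> i ` topspace D"
    by (auto simp: openin_subtopology)
  have "i d \<in> W"
    using W(2) d UV(4) by auto
  then have "(i d, y) \<in> W \<times> U" "openin (prod_topology K Y) (W \<times> U)"
    using W(1) UV(1,3) by (auto simp: openin_prod_Times_iff)
  then have "\<exists>z. z \<in> (\<lambda>x. (i x, f x)) ` topspace D \<and> z \<in> W \<times> U"
    using p [unfolded in_closure_of, THEN conjunct2, rule_format, of "W \<times> U"] by simp
  then obtain x where x: "x \<in> topspace D" "i x \<in> W" "f x \<in> U"
    by auto
  then have "i x \<in> i ` {x \<in> topspace D. f x \<in> V}"
    using W(2) by blast
  moreover have "inj_on i (topspace D)"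
    using i by (auto simp: embedding_map_def homeomorphic_eq_everything_map)
  ultimately have "f x \<in> V"
    using x(1) by (auto dest: inj_onD)
  then show False
    using x(3) UV(5) by (auto simp: disjnt_iff)
qed

text \<open>Let \<open>P\<close> be the closure in \<open>K \<times> Y\<close> of the pairs of images of the points of \<open>D\<close>. By the preceding
lemma and its mirror image, the points of \<open>P\<close> over the remainder of \<open>K\<close> are exactly those over the
remainder of \<open>Y\<close>. So if the remainder of \<open>K\<close> is a countable union of closed sets, the parts of \<open>P\<close>
over these sets project onto countably many closed sets whose union is the remainder of \<open>Y\<close>.\<close>

lemma gdelta_in_compactification:
  assumes K: "compactification D K i" and Y: "compactification D Y e"
    and g: "gdelta_in K (i ` topspace D)"
  shows "gdelta_in Y (e ` topspace D)"
proof -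
  let ?G = "(\<lambda>x. (i x, e x)) ` topspace D"
  define P where "P = prod_topology K Y closure_of ?G"
  have KY: "compact_space K" "Hausdorff_space K" "embedding_map D K i"
    "compact_space Y" "Hausdorff_space Y" "embedding_map D Y e" "dense_subset Y (e ` topspace D)"
    using K Y by (auto simp: compactification_def)
  have cont: "continuous_map D K i" "continuous_map D Y e"
    using KY(3,6) by (auto simp: embedding_map_def homeomorphic_eq_everything_map continuous_map_in_subtopology)
  have G: "?G \<subseteq> topspace (prod_topology K Y)"
    using cont by (auto simp: continuous_map_def)
  have cP: "closedin (prod_topology K Y) P" and GP: "?G \<subseteq> P"
    using closure_of_subset [OF G] by (auto simp: P_def)
  have snd_closed: "closed_map (prod_topology K Y) Y snd"
    by (rule closed_map_snd [OF KY(1)])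
  have snd_P: "snd ` P = topspace Y"
  proof
    show "snd ` P \<subseteq> topspace Y"
      using closedin_subset [OF cP] by auto
    have "closedin Y (snd ` P)"
      using snd_closed cP by (auto simp: closed_map_def)
    moreover have "e ` topspace D \<subseteq> snd ` P"
      using GP by force
    ultimately have "Y closure_of (e ` topspace D) \<subseteq> snd ` P"
      by (simp add: closure_of_minimal)
    then show "topspace Y \<subseteq> snd ` P"
      using KY(7) by (simp add: dense_subset_def)
  qed
  have one: "y = e d" if "(i d, y) \<in> P" "d \<in> topspace D" for d y
    using graph_closure_over_image [OF KY(3) cont(2) KY(5)] that by (simp add: P_def)
  have two: "k = i d" if "(k, e d) \<in> P" "d \<in> topspace D" for d k
  proof -
    let ?s = "\<lambda>(x, y). (y, x)"
    have "continuous_map (prod_topology K Y) (prod_topology Y K) ?s"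
      using homeomorphic_map_swap homeomorphic_imp_continuous_map by blast
    from continuous_map_image_closure_subset [OF this, of ?G]
    have "?s ` P \<subseteq> prod_topology Y K closure_of (?s ` ?G)"
      by (simp add: P_def)
    moreover have "?s ` ?G = (\<lambda>x. (e x, i x)) ` topspace D"
      by (auto simp: image_image)
    ultimately have "(e d, k) \<in> prod_topology Y K closure_of ((\<lambda>x. (e x, i x)) ` topspace D)"
      using that(1) by force
    then show ?thesis
      using graph_closure_over_image [OF KY(6) cont(1) KY(2)] that(2) by blast
  qed
  obtain C where C: "\<And>n :: nat. closedin K (C n)" "\<Union>(range C) = topspace K - i ` topspace D"
    using g unfolding gdelta_in_fsigma_in fsigma_in_ascending by metis
  define B where "B n = snd ` (P \<inter> C n \<times> topspace Y)" for n
  have B: "closedin Y (B n)" for n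
  proof -
    have "closedin (prod_topology K Y) (P \<inter> C n \<times> topspace Y)"
      by (intro closedin_Int cP) (simp add: closedin_prod_Times_iff C(1))
    then show ?thesis
      using snd_closed by (simp add: B_def closed_map_def)
  qed
  have UnB: "\<Union>(range B) = topspace Y - e ` topspace D"
  proof (intro subset_antisym subsetI)
    fix y assume "y \<in> \<Union>(range B)"
    then obtain n k where nk: "(k, y) \<in> P" "k \<in> C n" "y \<in> topspace Y"
      by (auto simp: B_def)
    have "k \<notin> i ` topspace D"
      using nk(2) C(2) by auto
    then show "y \<in> topspace Y - e ` topspace D"
      using nk(1,3) two by auto
  next
    fix y assume y: "y \<in> topspace Y - e ` topspace D"
    then obtain k where k: "(k, y) \<in> P"
      using snd_P by (metis DiffD1 imageE prod.collapse)
    then have "k \<in> topspace K"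
      using closedin_subset [OF cP] by auto
    moreover have "k \<notin> i ` topspace D"
      using one k y by auto
    ultimately obtain n where "k \<in> C n"
      using C(2) by blast
    then show "y \<in> \<Union>(range B)"
      using k y by (force simp: B_def)
  qed
  have "fsigma_in Y (\<Union>(range B))"
    by (rule fsigma_in_Union) (auto intro: closed_imp_fsigma_in B)
  then have "fsigma_in Y (topspace Y - e ` topspace D)"
    by (simp add: UnB)
  moreover have "e ` topspace D \<subseteq> topspace Y"
    using cont(2) by (auto simp: continuous_map_def)
  ultimately show ?thesis
    by (simp add: gdelta_in_fsigma_in)
qed

text \<open>The space \<open>W\<close> is a weak topology and need not be Hausdorff; the Baire category theorem holds for
compact regular spaces. If all members of \<open>\<N>\<close> were nowhere dense, the complements of their closures
and the sets in \<open>\<V>\<close> would have a common point. It would lie in \<open>E\<close>, but in no member of \<open>\<N>\<close>.\<close>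

lemma somewhere_dense_member:
  assumes "compact_space W" and "regular_space W"
    and "countable \<V>" and \<V>: "\<And>V. V \<in> \<V> \<Longrightarrow> openin W V \<and> W closure_of V = topspace W"
    and "topspace W \<inter> \<Inter>\<V> \<subseteq> E" and "E \<noteq> {}" and "E \<subseteq> topspace W"
    and "countable \<N>" and "\<Union>\<N> = E"
  shows "\<exists>N\<in>\<N>. W interior_of (W closure_of N) \<noteq> {}"
proof (rule ccontr)
  assume "\<not> ?thesis"
  then have nwd: "W interior_of (W closure_of N) = {}" if "N \<in> \<N>" for N
    using that by blast
  define \<G> where "\<G> = \<V> \<union> (\<lambda>N. topspace W - W closure_of N) ` \<N>"
  have "W closure_of \<Inter>\<G> = topspace W"
  proof (rule Baire_category)
    show "completely_metrizable_space W \<or> locally_compact_space W \<and> regular_space W"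
      using assms(1,2) compact_imp_locally_compact_space by blast
    show "countable \<G>"
      using assms(3,8) by (simp add: \<G>_def)
    fix G assume "G \<in> \<G>"
    then consider "G \<in> \<V>" | N where "N \<in> \<N>" "G = topspace W - W closure_of N"
      by (auto simp: \<G>_def)
    then show "openin W G \<and> W closure_of G = topspace W"
    proof cases
      case 1
      then show ?thesis by (rule \<V>)
    next
      case 2
      then show ?thesis
        using nwd [OF 2(1)] by (simp add: openin_diff closure_of_complement)
    qed
  qed
  moreover have "topspace W \<noteq> {}"
    using assms(6,7) by blast
  ultimately obtain x where x: "x \<in> topspace W \<inter> \<Inter>\<G>"
    by (metis closure_of_empty closure_of_restrict ex_in_conv)
  then have "x \<in> E"
    using assms(5) by (auto simp: \<G>_def)
  then obtain N where N: "N \<in> \<N>" "x \<in> N"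
    using assms(9) by blast
  have "N \<subseteq> topspace W"
    using N(1) assms(7,9) by blast
  then have "x \<in> W closure_of N"
    using closure_of_subset N(2) by blast
  moreover have "x \<in> topspace W - W closure_of N"
    using x N(1) by (auto simp: \<G>_def)
  ultimately show False by blast
qed

section \<open>Fibre invariant sets of functions\<close>

text \<open>\<open>G\<close> maps fibres of the evaluation map of \<open>S\<close> into fibres. This is weaker than asking that \<open>S\<close> be
closed under translation by \<open>G\<close>, and countable sets can satisfy it.\<close>

definition fibre_invariant ::
  "('g, 'm) monoid_scheme \<Rightarrow> 'b set \<Rightarrow> ('g \<Rightarrow> 'b \<Rightarrow> 'b) \<Rightarrow> ('b \<Rightarrow> real) set \<Rightarrow> bool" where
  "fibre_invariant G B \<theta> S \<longleftrightarrow>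
     (\<forall>g\<in>carrier G. \<forall>x\<in>B. \<forall>y\<in>B. (\<forall>s\<in>S. s x = s y) \<longrightarrow> (\<forall>s\<in>S. s (\<theta> g x) = s (\<theta> g y)))"

lemma fibre_invariant_Union:
  assumes "\<And>S. S \<in> \<C> \<Longrightarrow> fibre_invariant G B \<theta> S"
  shows "fibre_invariant G B \<theta> (\<Union>\<C>)"
  unfolding fibre_invariant_def
proof (intro ballI impI)
  fix g x y s
  assume g: "g \<in> carrier G" "x \<in> B" "y \<in> B" and eq: "\<forall>s\<in>\<Union>\<C>. s x = s y" and "s \<in> \<Union>\<C>"
  then obtain S where S: "S \<in> \<C>" "s \<in> S" by blast
  then have "\<forall>s\<in>S. s x = s y"
    using eq by blast
  then show "s (\<theta> g x) = s (\<theta> g y)"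
    using assms [OF S(1)] g S(2) unfolding fibre_invariant_def by blast
qed

text \<open>The set consists of a countable dense subset of the orbit of \<open>f\<close> and of \<open>f\<close> itself. For fixed
\<open>x\<close> and \<open>y\<close> the condition \<open>h x = h y\<close> is closed in the topology of pointwise convergence, so the
dense subset has the same fibres as the orbit, and the orbit is closed under translation.\<close>

lemma s_action_fibre_invariant:
  fixes G (structure)
  assumes act: "s_action G T Y \<theta>" and f: "continuous_map Y euclideanreal f"
  obtains S where "countable S" and "restrict f (topspace Y) \<in> S"
    and "\<And>s. s \<in> S \<Longrightarrow> continuous_map Y euclideanreal s"
    and "fibre_invariant G (topspace Y) \<theta> S"
proof -
  let ?B = "topspace Y"
  interpret group_action G ?B \<theta>
    using act by (simp add: s_action_def separately_continuous_action_def)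
  define F where "F = restrict f ?B"
  define Orb where "Orb = {restrict (\<lambda>z. F (\<theta> g z)) ?B | g. g \<in> carrier G}"
  have grp: "group G"
    using group_hom group_hom.axioms(1) by blast
  have "continuous_map Y euclideanreal F"
    using f by (rule continuous_map_eq) (simp add: F_def)
  then have F: "F \<in> topspace (Cp Y)"
    by (auto simp: Cp_def F_def)
  then have "separable_space (subtopology (Cp Y) Orb)"
    using act unfolding s_action_def Orb_def by blast
  then obtain C where C: "countable C" "C \<subseteq> topspace (subtopology (Cp Y) Orb)"
      "subtopology (Cp Y) Orb closure_of C = topspace (subtopology (Cp Y) Orb)"
    unfolding separable_space_def by blast
  have cont_comp: "continuous_map Y euclideanreal (restrict (\<lambda>z. F (\<theta> g z)) ?B)" if g: "g \<in> carrier G" for g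
  proof -
    have "continuous_map Y Y (\<theta> g)"
      using act g by (simp add: s_action_def separately_continuous_action_def)
    then have "continuous_map Y euclideanreal (F \<circ> \<theta> g)"
      using \<open>continuous_map Y euclideanreal F\<close> by (rule continuous_map_compose)
    then show ?thesis
      by (rule continuous_map_eq) simp
  qed
  have Orb_sub: "Orb \<subseteq> topspace (Cp Y)"
    using cont_comp by (auto simp: Orb_def Cp_def)
  have one: "F = restrict (\<lambda>z. F (\<theta> \<one> z)) ?B"
  proof
    fix z
    have "z \<in> ?B \<Longrightarrow> \<theta> \<one> z = z"
      using fun_cong [OF id_eq_one, of z] by simp
    then show "F z = restrict (\<lambda>z. F (\<theta> \<one> z)) ?B z"
      by (simp add: F_def)
  qed
  have "F \<in> Orb"
    unfolding Orb_def using one group.is_monoid [OF grp] monoid.one_closed by blast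
  define S where "S = insert F C"
  have S_Orb: "S \<subseteq> Orb"
    using C(2) \<open>F \<in> Orb\<close> by (auto simp: S_def)
  have fib: "h x = h y" if eq: "\<forall>s\<in>S. s x = s y" and xy: "x \<in> ?B" "y \<in> ?B" and h: "h \<in> Orb" for h x y
  proof -
    let ?Q = "subtopology (Cp Y) Orb"
    have proj: "continuous_map ?Q euclideanreal (\<lambda>h. h z)" if "z \<in> ?B" for z
      unfolding Cp_def
      by (intro continuous_map_from_subtopology continuous_map_product_projection that)
    have "closedin ?Q {h \<in> topspace ?Q. h x = h y}"
      by (rule closedin_continuous_maps_eq [OF _ proj [OF xy(1)] proj [OF xy(2)]]) simp
    moreover have "C \<subseteq> {h \<in> topspace ?Q. h x = h y}"
      using C(2) eq by (auto simp: S_def)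
    ultimately have "?Q closure_of C \<subseteq> {h \<in> topspace ?Q. h x = h y}"
      by (simp add: closure_of_minimal)
    then show ?thesis
      using C(3) h Orb_sub by auto
  qed
  show thesis
  proof
    show "countable S" using C(1) by (simp add: S_def)
    show "restrict f ?B \<in> S" by (simp add: S_def F_def)
    show "continuous_map Y euclideanreal s" if "s \<in> S" for s
      using S_Orb that cont_comp by (auto simp: Orb_def)
    show "fibre_invariant G ?B \<theta> S"
      unfolding fibre_invariant_def
    proof (intro ballI impI)
      fix g x y s
      assume g: "g \<in> carrier G" and xy: "x \<in> ?B" "y \<in> ?B" and eq: "\<forall>s\<in>S. s x = s y" and "s \<in> S"
      then obtain a where a: "a \<in> carrier G" "s = restrict (\<lambda>z. F (\<theta> a z)) ?B"
        using S_Orb by (auto simp: Orb_def)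
      have ag: "a \<otimes> g \<in> carrier G"
        using a g group.is_monoid [OF grp] monoid.m_closed by metis
      have "s (\<theta> g z) = restrict (\<lambda>z. F (\<theta> (a \<otimes> g) z)) ?B z" if "z \<in> ?B" for z
        using that element_image [OF g that refl] composition_rule [OF that a(1) g] by (simp add: a(2))
      moreover have "restrict (\<lambda>z. F (\<theta> (a \<otimes> g) z)) ?B \<in> Orb"
        using ag by (auto simp: Orb_def)
      ultimately show "s (\<theta> g x) = s (\<theta> g y)"
        using fib [OF eq xy] xy by metis
    qed
  qed
qed

text \<open>If \<open>E\<close> is the intersection of the open sets \<open>C n\<close>, take Urysohn functions vanishing on \<open>K\<close> and equal
to 1 outside \<open>C n\<close>. For fixed \<open>n\<close> the points at which one of them is below 1 form a set between
\<open>\<Union>\<K>\<close> and \<open>C n\<close>, open in every weak topology for which these functions are continuous. The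
functions are extensional because the points of \<open>C\<^sub>p(Y)\<close> are.\<close>

lemma dense_gdelta_functions:
  assumes Y: "compact_space Y" "Hausdorff_space Y" and E: "gdelta_in Y E"
    and \<K>: "countable \<K>" "\<And>K. K \<in> \<K> \<Longrightarrow> compactin Y K \<and> K \<subseteq> E" "dense_subset Y (\<Union>\<K>)"
  obtains \<F> where "countable \<F>" and "\<forall>f\<in>\<F>. continuous_map Y euclideanreal f"
    and "\<F> \<subseteq> extensional (topspace Y)"
    and "\<forall>S. \<F> \<subseteq> S \<and> (\<forall>s\<in>S. continuous_map Y euclideanreal s) \<longrightarrow>
      (\<exists>\<V>. countable \<V> \<and> topspace Y \<inter> \<Inter>\<V> \<subseteq> E \<and>
        (\<forall>V\<in>\<V>. openin (weak_topology (topspace Y) S) V \<and>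
           weak_topology (topspace Y) S closure_of V = topspace Y))"
proof -
  obtain C where C: "\<And>n :: nat. openin Y (C n)" "\<Inter>(range C) = E"
    using E unfolding gdelta_in_descending by metis
  have "\<exists>f. continuous_map Y euclideanreal f \<and> f \<in> extensional (topspace Y) \<and>
      f ` K \<subseteq> {0} \<and> f ` (topspace Y - C n) \<subseteq> {1}" if K: "K \<in> \<K>" for K n
  proof -
    have "normal_space Y"
      using Y compact_Hausdorff_or_regular_imp_normal_space by blast
    moreover have "closedin Y K"
      using \<K>(2) [OF K] Y(2) compactin_imp_closedin by blast
    moreover have "closedin Y (topspace Y - C n)"
      using C(1) by blast
    moreover have "disjnt K (topspace Y - C n)"
      using \<K>(2) [OF K] C(2) by (auto simp: disjnt_iff)
    ultimately obtain f where f: "continuous_map Y euclideanreal f" "f ` K \<subseteq> {0}"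
        "f ` (topspace Y - C n) \<subseteq> {1::real}"
      by (rule Urysohn_lemma_alt)
    have "K \<subseteq> topspace Y"
      using \<K>(2) [OF K] compactin_subset_topspace by blast
    then have "restrict f (topspace Y) ` K \<subseteq> {0}"
      using f(2) by auto
    moreover have "restrict f (topspace Y) ` (topspace Y - C n) \<subseteq> {1}"
      using f(3) by auto
    moreover have "continuous_map Y euclideanreal (restrict f (topspace Y))"
      using f(1) by (rule continuous_map_eq) simp
    ultimately show ?thesis
      by (intro exI [of _ "restrict f (topspace Y)"]) auto
  qed
  then obtain \<phi> where \<phi>: "\<And>K n. K \<in> \<K> \<Longrightarrow> continuous_map Y euclideanreal (\<phi> K n) \<and>
      \<phi> K n \<in> extensional (topspace Y) \<and> \<phi> K n ` K \<subseteq> {0} \<and> \<phi> K n ` (topspace Y - C n) \<subseteq> {1}"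
    by metis
  show thesis
  proof
    let ?F = "(\<lambda>(K, n). \<phi> K n) ` (\<K> \<times> UNIV)"
    show "countable ?F"
      using \<K>(1) by simp
    show "\<forall>f\<in>?F. continuous_map Y euclideanreal f"
      using \<phi> by auto
    show "?F \<subseteq> extensional (topspace Y)"
      using \<phi> by auto
    show "\<forall>S. ?F \<subseteq> S \<and> (\<forall>s\<in>S. continuous_map Y euclideanreal s) \<longrightarrow>
      (\<exists>\<V>. countable \<V> \<and> topspace Y \<inter> \<Inter>\<V> \<subseteq> E \<and>
        (\<forall>V\<in>\<V>. openin (weak_topology (topspace Y) S) V \<and>
           weak_topology (topspace Y) S closure_of V = topspace Y))"
    proof (intro allI impI, elim conjE)
      fix S assume S: "?F \<subseteq> S" and "\<forall>s\<in>S. continuous_map Y euclideanreal s"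
      then have cS: "continuous_map Y euclideanreal s" if "s \<in> S" for s
        using that by blast
      let ?W = "weak_topology (topspace Y) S"
      define V where "V n = (\<Union>K\<in>\<K>. {y \<in> topspace Y. \<phi> K n y \<in> {..<1}})" for n
      have opn: "openin ?W (V n)" for n
        unfolding V_def
      proof (intro openin_Union ballI, clarify)
        fix K assume "K \<in> \<K>"
        then have "\<phi> K n \<in> S"
          using S by force
        from openin_continuous_map_preimage [OF continuous_map_weak_topology [OF this], of "{..<1}"]
        show "openin ?W {y \<in> topspace Y. \<phi> K n y \<in> {..<1}}" by simp
      qed
      have dns: "?W closure_of V n = topspace Y" for n
      proof -
        have "\<Union>\<K> \<subseteq> V n"
        proof
          fix y assume "y \<in> \<Union>\<K>"
          then obtain K where K: "K \<in> \<K>" "y \<in> K" by blast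
          then have "\<phi> K n y = 0" "y \<in> topspace Y"
            using \<phi> [OF K(1), of n] \<K>(2) [OF K(1)] compactin_subset_topspace by auto
          then show "y \<in> V n"
            using K(1) by (auto simp: V_def intro!: bexI [of _ K])
        qed
        moreover have "topspace Y \<subseteq> ?W closure_of \<Union>\<K>"
        proof
          fix y assume y: "y \<in> topspace Y"
          then have y': "y \<in> Y closure_of \<Union>\<K>"
            using \<K>(3) by (simp add: dense_subset_def)
          show "y \<in> ?W closure_of \<Union>\<K>"
            unfolding in_closure_of
          proof (intro conjI allI impI)
            fix N assume "y \<in> N \<and> openin ?W N"
            then have "y \<in> N \<and> openin Y N"
              using openin_weak_topology_coarser [OF cS] by blast
            then show "\<exists>z. z \<in> \<Union>\<K> \<and> z \<in> N"
              using y' [unfolded in_closure_of] by blast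
          qed (simp add: y)
        qed
        ultimately have "topspace Y \<subseteq> ?W closure_of V n"
          using closure_of_mono by (metis subset_trans)
        then show ?thesis
          using closure_of_subset_topspace [of ?W "V n"] by simp
      qed
      have "topspace Y \<inter> \<Inter>(range V) \<subseteq> E"
      proof
        fix y assume y: "y \<in> topspace Y \<inter> \<Inter>(range V)"
        have "y \<in> C n" for n
        proof (rule ccontr)
          assume "y \<notin> C n"
          moreover obtain K where "K \<in> \<K>" "\<phi> K n y < 1"
            using y by (auto simp: V_def)
          ultimately show False
            using \<phi> [of K n] y by force
        qed
        then show "y \<in> E"
          using C(2) by blast
      qed
      then show "\<exists>\<V>. countable \<V> \<and> topspace Y \<inter> \<Inter>\<V> \<subseteq> E \<and>
          (\<forall>V\<in>\<V>. openin ?W V \<and> ?W closure_of V = topspace Y)"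
        using opn dns by (intro exI [of _ "range V"]) auto
    qed
  qed
qed

section \<open>Translates of open sets\<close>

lemma continuous_map_weak_topology_action:
  assumes "compact_space Y" and cS: "\<And>s. s \<in> S \<Longrightarrow> continuous_map Y euclideanreal s"
    and inv: "fibre_invariant G (topspace Y) \<theta> S"
    and g: "g \<in> carrier G" and cont: "continuous_map Y Y (\<theta> g)"
  shows "continuous_map (weak_topology (topspace Y) S) (weak_topology (topspace Y) S) (\<theta> g)"
  unfolding continuous_map_into_weak_topology
proof (intro conjI ballI)
  show "\<theta> g \<in> topspace (weak_topology (topspace Y) S) \<rightarrow> topspace Y"
    using cont by (auto simp: continuous_map_def)
  fix s assume s: "s \<in> S"
  show "continuous_map (weak_topology (topspace Y) S) euclideanreal (\<lambda>y. s (\<theta> g y))"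
  proof (rule continuous_map_weak_topology_of_fibres [OF assms(1)])
    show "continuous_map Y euclideanreal s" if "s \<in> S" for s
      using that by (rule cS)
    show "continuous_map Y euclideanreal (\<lambda>y. s (\<theta> g y))"
      using continuous_map_compose [OF cont cS [OF s]] by (simp add: comp_def)
    fix x y assume "x \<in> topspace Y" "y \<in> topspace Y" "\<And>s. s \<in> S \<Longrightarrow> s x = s y"
    then show "s (\<theta> g x) = s (\<theta> g y)"
      using inv g s unfolding fibre_invariant_def by blast
  qed
qed

text \<open>For \<open>x\<close> in \<open>U\<close>, the elements \<open>g\<close> with \<open>g x \<in> U\<close> form a neighbourhood \<open>N\<close> of the neutral element.
If the translates of \<open>N\<close> by a countable set \<open>C\<close> cover \<open>G\<close>, then the translates of \<open>U\<close> by \<open>C\<close> cover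
the orbit of \<open>x\<close>.\<close>

lemma countable_translates_cover:
  fixes G (structure)
  assumes G: "semitopological_group G T" "omega_narrow G T"
    and act: "separately_continuous_action G T X \<theta>" "transitive_action G (topspace X) \<theta>"
    and U: "openin X U" "U \<noteq> {}"
  obtains C where "countable C" and "C \<subseteq> carrier G" and "(\<Union>a\<in>C. \<theta> a ` U) = topspace X"
proof -
  interpret transitive_action G "topspace X" \<theta>
    by (rule act(2))
  obtain x where x: "x \<in> U" using U(2) by blast
  have UX: "U \<subseteq> topspace X" using openin_subset [OF U(1)] .
  define N where "N = {g \<in> carrier G. \<theta> g x \<in> U}"
  have "continuous_map T X (\<lambda>g. \<theta> g x)" and TG: "topspace T = carrier G"
    using G(1) act(1) x UX by (auto simp: separately_continuous_action_def semitopological_group_def)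
  then have "openin T N"
    using openin_continuous_map_preimage [OF _ U(1)] by (fastforce simp: N_def)
  moreover have "\<one> \<in> N"
  proof -
    have "group G"
      using G(1) by (simp add: semitopological_group_def)
    then have "\<one> \<in> carrier G"
      by (simp add: group.is_monoid monoid.one_closed)
    moreover have "x \<in> topspace X"
      using x UX by blast
    then have "\<theta> \<one> x = x"
      using fun_cong [OF id_eq_one, of x] by simp
    ultimately show ?thesis
      using x by (simp add: N_def)
  qed
  ultimately have "N \<subseteq> carrier G \<and> (\<exists>V. openin T V \<and> \<one> \<in> V \<and> V \<subseteq> N)"
    by (auto simp: N_def)
  then obtain C where C: "countable C" "C \<subseteq> carrier G" "C <#> N = carrier G"
    using G(2) [unfolded omega_narrow_def, rule_format, of N] by blast
  have "(\<Union>a\<in>C. \<theta> a ` U) = topspace X"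
  proof (intro subset_antisym subsetI)
    fix z assume "z \<in> (\<Union>a\<in>C. \<theta> a ` U)"
    then show "z \<in> topspace X"
      using C(2) UX element_image by blast
  next
    fix z assume z: "z \<in> topspace X"
    obtain g where g: "g \<in> carrier G" "\<theta> g x = z"
      using unique_orbit [of x z] x UX z by blast
    have "g \<in> C <#> N"
      using g(1) C(3) by simp
    then obtain a n where an: "a \<in> C" "n \<in> N" "g = a \<otimes> n"
      by (auto simp: set_mult_def)
    have n: "\<theta> n x \<in> U" "n \<in> carrier G" "a \<in> carrier G"
      using an C(2) by (auto simp: N_def)
    then have "z = \<theta> a (\<theta> n x)"
      using composition_rule [of x a n] g(2) an(3) x UX by auto
    then show "z \<in> (\<Union>a\<in>C. \<theta> a ` U)"
      using an(1) n(1) by blast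
  qed
  with C(1,2) show thesis
    using that by blast
qed

lemma somewhere_dense_translate:
  fixes G (structure)
  assumes "group_action G (topspace W) \<theta>" and act: "\<And>g. g \<in> carrier G \<Longrightarrow> continuous_map W W (\<theta> g)"
    and a: "a \<in> carrier G" and U: "U \<subseteq> topspace W"
    and dense: "W interior_of (W closure_of (\<theta> a ` U)) \<noteq> {}"
  shows "W interior_of (W closure_of U) \<noteq> {}"
proof -
  interpret group_action G "topspace W" \<theta>
    by (rule assms(1))
  have grp: "group G"
    using group_hom group_hom.axioms(1) by blast
  have b: "inv a \<in> carrier G"
    using group.inv_closed [OF grp a] .
  have inv_a: "\<theta> (inv a) (\<theta> a y) = y" "\<theta> a (\<theta> (inv a) y) = y" if "y \<in> topspace W" for y
    using composition_rule [OF that a b] composition_rule [OF that b a]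
      fun_cong [OF id_eq_one, of y] that group.l_inv [OF grp a] group.r_inv [OF grp a] by auto
  let ?I = "W interior_of (W closure_of (\<theta> a ` U))"
  define V where "V = {y \<in> topspace W. \<theta> a y \<in> ?I}"
  have "openin W V"
    unfolding V_def using act [OF a] by (rule openin_continuous_map_preimage) simp
  moreover have "V \<subseteq> W closure_of U"
  proof
    fix y assume y: "y \<in> V"
    then have "\<theta> a y \<in> W closure_of (\<theta> a ` U)" and yW: "y \<in> topspace W"
      using interior_of_subset [of W "W closure_of (\<theta> a ` U)"] by (auto simp: V_def)
    then have "\<theta> (inv a) (\<theta> a y) \<in> \<theta> (inv a) ` (W closure_of (\<theta> a ` U))"
      by blast
    then have "y \<in> W closure_of (\<theta> (inv a) ` \<theta> a ` U)"
      using continuous_map_image_closure_subset [OF act [OF b], of "\<theta> a ` U"] inv_a(1) [OF yW] by auto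
    moreover have "\<theta> (inv a) ` \<theta> a ` U = U"
      using inv_a(1) U by (force simp: image_image)
    ultimately show "y \<in> W closure_of U" by simp
  qed
  ultimately have "V \<subseteq> W interior_of (W closure_of U)"
    by (simp add: interior_of_maximal)
  moreover have "V \<noteq> {}"
  proof -
    obtain v where v: "v \<in> ?I"
      using dense by blast
    then have "v \<in> topspace W"
      using interior_of_subset_topspace [of W] by auto
    then have "\<theta> (inv a) v \<in> V"
      using v inv_a(2) element_image [OF b] by (auto simp: V_def)
    then show ?thesis by blast
  qed
  ultimately show ?thesis by blast
qed

text \<open>Used with \<open>A\<close> the points of \<open>X\<close>, embedded by \<open>e\<close> as a dense subset of \<open>Y\<close>, so that the interior
found in \<open>Y\<close> meets the image of \<open>X\<close>.\<close>

lemma somewhere_dense_pullback: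
  assumes e: "e \<in> A \<rightarrow> topspace W" and U: "U \<subseteq> A"
    and meets: "\<And>V. openin W V \<Longrightarrow> V \<noteq> {} \<Longrightarrow> V \<inter> e ` A \<noteq> {}"
    and dense: "W interior_of (W closure_of (e ` U)) \<noteq> {}"
  shows "pullback_topology A e W interior_of (pullback_topology A e W closure_of U) \<noteq> {}"
proof -
  let ?P = "pullback_topology A e W" and ?I = "W interior_of (W closure_of (e ` U))"
  have "openin ?P (e -` ?I \<inter> A)"
    unfolding openin_pullback_topology using openin_interior_of by blast
  moreover have "e -` ?I \<inter> A \<subseteq> ?P closure_of U"
  proof
    fix z assume z: "z \<in> e -` ?I \<inter> A"
    show "z \<in> ?P closure_of U"
      unfolding in_closure_of
    proof (intro conjI allI impI)
      show "z \<in> topspace ?P"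
        using z e by (auto simp: topspace_pullback_topology)
      fix M assume "z \<in> M \<and> openin ?P M"
      then obtain M' where M': "openin W M'" "M = e -` M' \<inter> A" "e z \<in> M'"
        by (auto simp: openin_pullback_topology)
      have "e z \<in> W closure_of (e ` U)"
        using z interior_of_subset [of W "W closure_of (e ` U)"] by auto
      then obtain u where "u \<in> U" "e u \<in> M'"
        using M'(1,3) unfolding in_closure_of by blast
      then show "\<exists>y. y \<in> U \<and> y \<in> M"
        using M'(2) U by blast
    qed
  qed
  ultimately have "e -` ?I \<inter> A \<subseteq> ?P interior_of (?P closure_of U)"
    by (simp add: interior_of_maximal)
  moreover have "e -` ?I \<inter> A \<noteq> {}"
    using meets [OF openin_interior_of dense] by blast
  ultimately show ?thesis by blast
qed

section \<open>Orbits in compactifications\<close>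

theorem theorem1p4:
  fixes G :: "('g, 'm) monoid_scheme" and T :: "'g topology"
    and X :: "'a topology" and Y :: "'b topology"
    and \<theta> :: "'g \<Rightarrow> 'a \<Rightarrow> 'a" and \<theta>' :: "'g \<Rightarrow> 'b \<Rightarrow> 'b"
    and e :: "'a \<Rightarrow> 'b" and D :: "'a set"
  assumes "semitopological_group G T" and "omega_narrow G T"
    and "Tychonoff_space X"
    and "separately_continuous_action G T X \<theta>"
    and "transitive_action G (topspace X) \<theta>"
    and "compactification X Y e"
    and "s_action G T Y \<theta>'"
    and "\<And>g x. g \<in> carrier G \<Longrightarrow> x \<in> topspace X \<Longrightarrow> \<theta>' g (e x) = e (\<theta> g x)"
    and "dense_subset X D"
    and "Cech_complete_space (subtopology X D)"
    and "k_separable_space (subtopology X D)"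
  shows "skeletally_Dugundji X"
proof -
  let ?A = "topspace X" and ?B = "topspace Y"
  interpret GY: group_action G ?B \<theta>'
    using assms(7) by (simp add: s_action_def separately_continuous_action_def)
  have Y: "compact_space Y" "Hausdorff_space Y" "embedding_map X Y e" "dense_subset Y (e ` ?A)"
    using assms(6) by (auto simp: compactification_def)
  have e: "continuous_map X Y e"
    using Y(3) by (auto simp: embedding_map_def homeomorphic_eq_everything_map
        continuous_map_in_subtopology)
  then have eB: "e \<in> ?A \<rightarrow> ?B"
    by (auto simp: continuous_map_def)
  have DX: "D \<subseteq> ?A"
    using assms(9) by (simp add: dense_subset_def)

  have "embedding_map (subtopology X D) X (\<lambda>x. x)"
    using DX by (simp add: embedding_map_def homeomorphic_map_id [unfolded id_def] Int_absorb1)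
  from embedding_map_compose [OF this Y(3)] have "embedding_map (subtopology X D) Y e"
    by (simp add: comp_def)
  then have cD: "compactification (subtopology X D) Y e"
    using Y DX dense_subset_image [OF e Y(4) assms(9)] by (simp add: compactification_def Int_absorb1)
  obtain K :: "(('a \<Rightarrow> real) \<Rightarrow> real) topology" and i where
    "compactification (subtopology X D) K i" "gdelta_in K (i ` topspace (subtopology X D))"
    using assms(10) unfolding Cech_complete_space_def by blast
  from gdelta_in_compactification [OF this(1) cD this(2)]
  have gD: "gdelta_in Y (e ` D)"
    using DX by (simp add: Int_absorb1)

  obtain \<L> where \<L>: "countable \<L>" "\<And>L. L \<in> \<L> \<Longrightarrow> compactin (subtopology X D) L"
      "dense_subset (subtopology X D) (\<Union>\<L>)"
    using assms(11) unfolding k_separable_space_def by blast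
  have K1: "compactin Y L \<and> L \<subseteq> e ` D" if L: "L \<in> (`) e ` \<L>" for L
  proof -
    obtain L' where L': "L' \<in> \<L>" "L = e ` L'"
      using L by blast
    then have "compactin X L'" "L' \<subseteq> D"
      using \<L>(2) [OF L'(1)] by (auto simp: compactin_subtopology)
    then show ?thesis
      using image_compactin [OF _ e] L'(2) by blast
  qed
  have "dense_subset X (\<Union>\<L>)"
    by (rule dense_subset_trans [OF assms(9) \<L>(3)])
  then have K2: "dense_subset Y (\<Union>((`) e ` \<L>))"
    using dense_subset_image [OF e Y(4), of "\<Union>\<L>"] by (simp add: image_Union [symmetric])
  obtain \<F> where \<F>: "countable \<F>" "\<forall>f\<in>\<F>. continuous_map Y euclideanreal f"
      "\<F> \<subseteq> extensional ?B"
    and big: "\<forall>S. \<F> \<subseteq> S \<and> (\<forall>s\<in>S. continuous_map Y euclideanreal s) \<longrightarrow>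
      (\<exists>\<V>. countable \<V> \<and> ?B \<inter> \<Inter>\<V> \<subseteq> e ` D \<and>
        (\<forall>V\<in>\<V>. openin (weak_topology ?B S) V \<and> weak_topology ?B S closure_of V = ?B))"
    by (rule dense_gdelta_functions [OF Y(1,2) gD countable_image [OF \<L>(1)] K1 K2])
       (assumption, rule that)

  define good where "good S \<longleftrightarrow> countable S \<and> (\<forall>s\<in>S. continuous_map Y euclideanreal s) \<and>
      fibre_invariant G ?B \<theta>' S" for S
  have "\<exists>S. good S \<and> restrict f ?B \<in> S" if "continuous_map Y euclideanreal f" for f
    using s_action_fibre_invariant [OF assms(7) that] unfolding good_def by metis
  then obtain \<sigma> where \<sigma>: "\<And>f. continuous_map Y euclideanreal f \<Longrightarrow> good (\<sigma> f) \<and> restrict f ?B \<in> \<sigma> f"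
    by metis
  \<comment> \<open>\<open>B0\<close> contains the Urysohn functions that make the image of \<open>D\<close> large in weak topologies.\<close>
  define B0 where "B0 = \<Union>(\<sigma> ` \<F>)"
  have "good B0"
    unfolding good_def
  proof (intro conjI)
    show "countable B0"
      using \<F>(1,2) \<sigma> by (auto simp: B0_def good_def)
    show "\<forall>s\<in>B0. continuous_map Y euclideanreal s"
      using \<F>(2) \<sigma> by (auto simp: B0_def good_def)
    show "fibre_invariant G ?B \<theta>' B0"
      unfolding B0_def
      by (rule fibre_invariant_Union) (use \<F>(2) \<sigma> in \<open>auto simp: good_def\<close>)
  qed
  have \<F>_B0: "\<F> \<subseteq> B0"
  proof
    fix f assume f: "f \<in> \<F>"
    then have "restrict f ?B = f"
      using \<F>(3) extensional_restrict by blast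
    then show "f \<in> B0"
      using f \<sigma> [OF bspec [OF \<F>(2) f]] by (auto simp: B0_def)
  qed

  let ?c = "\<lambda>S. (\<lambda>s. s \<circ> e) ` S"
  define \<S> where "\<S> = {?c S | S. good S}"
  show ?thesis
  proof (rule skeletally_Dugundji_criterion)
    show "Hausdorff_space X"
      using assms(3) by (simp add: Tychonoff_space_def)
    show "countable S" if "S \<in> \<S>" for S
      using that by (auto simp: \<S>_def good_def)
    show "continuous_map X euclideanreal s" if "S \<in> \<S>" "s \<in> S" for S s
      using that continuous_map_compose [OF e] by (auto simp: \<S>_def good_def)
    show "?c B0 \<in> \<S>"
      using \<open>good B0\<close> by (auto simp: \<S>_def)
  next
    fix U x assume U: "openin X U" "x \<in> U"
    then have xA: "x \<in> ?A"
      using openin_subset by blast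
    have "openin (subtopology Y (e ` ?A)) (e ` U)"
      using homeomorphic_map_openness [OF Y(3) [unfolded embedding_map_def] openin_subset [OF U(1)]]
        U(1) by simp
    then obtain W where W: "openin Y W" "e ` U = W \<inter> e ` ?A"
      by (auto simp: openin_subtopology)
    have "completely_regular_space Y"
      using Y(1,2) compact_Hausdorff_or_regular_imp_normal_space
        normal_imp_completely_regular_space by blast
    moreover have "closedin Y (?B - W)" "e x \<in> ?B - (?B - W)"
      using W U(2) xA eB by auto
    ultimately obtain f where f: "continuous_map Y (top_of_set {0..1::real}) f" "f (e x) = 0"
        "f ` (?B - W) \<subseteq> {1}"
      unfolding completely_regular_space_def by blast
    then have f': "continuous_map Y euclideanreal f"
      by (simp add: continuous_map_in_subtopology)
    have "z \<in> U" if z: "z \<in> ?A" "(restrict f ?B \<circ> e) z \<in> {..<1}" for z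
    proof -
      have "e z \<in> ?B"
        using z(1) eB by blast
      moreover from this have "f (e z) < 1"
        using z(2) by simp
      ultimately have "e z \<in> e ` U"
        using f(3) W(2) z(1) by force
      moreover have "inj_on e ?A"
        using Y(3) by (auto simp: embedding_map_def homeomorphic_eq_everything_map)
      ultimately show ?thesis
        using z(1) openin_subset [OF U(1)] by (auto dest: inj_onD)
    qed
    moreover have "(restrict f ?B \<circ> e) x \<in> {..<1}"
      using f(2) xA eB by auto
    moreover have "restrict f ?B \<circ> e \<in> ?c (\<sigma> f)" "?c (\<sigma> f) \<in> \<S>"
      using \<sigma> [OF f'] by (auto simp: \<S>_def)
    moreover have "open {..<1::real}"
      by simp
    ultimately show "\<exists>S\<in>\<S>. \<exists>s\<in>S. \<exists>V. open V \<and> s x \<in> V \<and> (\<forall>z\<in>?A. s z \<in> V \<longrightarrow> z \<in> U)"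
      by metis
  next
    fix \<A> U assume \<A>: "\<A> \<subseteq> \<S>" "?c B0 \<in> \<A>" and U: "openin X U" "U \<noteq> {}"
    \<comment> \<open>Returning from functions on \<open>X\<close> to functions on \<open>Y\<close>, where \<open>G\<close> acts on the weak topology.\<close>
    define \<C> where "\<C> = {S. good S \<and> ?c S \<in> \<A>}"
    define S where "S = \<Union>\<C>"
    have "\<A> = ?c ` \<C>"
      using \<A>(1) by (auto simp: \<C>_def \<S>_def)
    then have "\<Union>\<A> = ?c S"
      by (auto simp: S_def)
    have cS: "continuous_map Y euclideanreal s" if "s \<in> S" for s
      using that by (auto simp: S_def \<C>_def good_def)
    have inv: "fibre_invariant G ?B \<theta>' S"
      unfolding S_def by (rule fibre_invariant_Union) (auto simp: \<C>_def good_def)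
    have "B0 \<subseteq> S"
      using \<A>(2) \<open>good B0\<close> by (auto simp: S_def \<C>_def)
    let ?W = "weak_topology ?B S"
    have W: "compact_space ?W" "regular_space ?W"
      using compact_space_weak_topology [OF Y(1) cS] completely_regular_space_weak_topology
        completely_regular_imp_regular_space by blast+
    have act: "continuous_map ?W ?W (\<theta>' g)" if g: "g \<in> carrier G" for g
    proof (rule continuous_map_weak_topology_action [OF Y(1) cS inv g])
      show "continuous_map Y Y (\<theta>' g)"
        using assms(7) g by (simp add: s_action_def separately_continuous_action_def)
    qed

    have UA: "U \<subseteq> ?A" using openin_subset [OF U(1)] .
    obtain C where C: "countable C" "C \<subseteq> carrier G" "(\<Union>a\<in>C. \<theta> a ` U) = ?A"
      using countable_translates_cover [OF assms(1,2,4,5) U] by blast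
    have "\<theta>' a ` e ` U = e ` \<theta> a ` U" if "a \<in> C" for a
      using assms(8) that C(2) UA by (force simp: image_image)
    then have cover: "(\<Union>a\<in>C. \<theta>' a ` e ` U) = e ` ?A"
      unfolding C(3) [symmetric] image_UN by simp
    obtain \<V> where \<V>: "countable \<V>" "?B \<inter> \<Inter>\<V> \<subseteq> e ` D"
        "\<And>V. V \<in> \<V> \<Longrightarrow> openin ?W V \<and> ?W closure_of V = ?B"
      using big [rule_format, of S] subset_trans [OF \<F>_B0 \<open>B0 \<subseteq> S\<close>] cS by auto
    have "\<exists>N\<in>(\<lambda>a. \<theta>' a ` e ` U) ` C. ?W interior_of (?W closure_of N) \<noteq> {}"
    proof (rule somewhere_dense_member [OF W \<V>(1), where E = "e ` ?A"])
      show "topspace ?W \<inter> \<Inter>\<V> \<subseteq> e ` ?A"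
        using subset_trans [OF \<V>(2) image_mono [OF DX]] by simp
      show "e ` ?A \<subseteq> topspace ?W"
        using eB by auto
    qed (use \<V>(3) U(2) UA C(1) cover in auto)
    then obtain a where a: "a \<in> C" "?W interior_of (?W closure_of (\<theta>' a ` e ` U)) \<noteq> {}"
      by blast
    have "?W interior_of (?W closure_of (e ` U)) \<noteq> {}"
    proof (rule somewhere_dense_translate [OF _ act])
      show "group_action G (topspace ?W) \<theta>'"
        using GY.group_action_axioms by simp
      show "e ` U \<subseteq> topspace ?W"
        using UA eB by auto
    qed (use a C(2) in auto)
    moreover have "V \<inter> e ` ?A \<noteq> {}" if V: "openin ?W V" "V \<noteq> {}" for V
    proof -
      obtain v where v: "v \<in> V" using V(2) by blast
      have "openin Y V"
        by (rule openin_weak_topology_coarser [OF cS V(1)])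
      moreover from this have "v \<in> Y closure_of (e ` ?A)"
        using Y(4) v openin_subset [of Y V] by (auto simp: dense_subset_def)
      ultimately show ?thesis
        using v unfolding in_closure_of by blast
    qed
    ultimately have "pullback_topology ?A e ?W interior_of (pullback_topology ?A e ?W closure_of U) \<noteq> {}"
      using eB UA by (intro somewhere_dense_pullback) auto
    then show "weak_topology ?A (\<Union>\<A>) interior_of (weak_topology ?A (\<Union>\<A>) closure_of U) \<noteq> {}"
      unfolding \<open>\<Union>\<A> = ?c S\<close> weak_topology_comp [OF eB] .
  qed
qed

end
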